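(* Let $T$ be a finite tree with a unique vertex of maximal degree $d$, with $d\ge 4$. Then there is no (countable) weakly universal $T$-free graph.
   Context: All graphs are simple, undirected, and finite or countably infinite ("countable"). A graph $G$ is $T$-free if it contains no (not necessarily induced) subgraph isomorphic to $T$. A countable $T$-free graph $G$ is weakly universal if every countable $T$-free graph is isomorphic to a subgraph of $G$. *)

theory Defs
  imports "Graph_Theory.Graph_Theory" "HOL-Library.Countable_Set"
begin

text \<open>
  A simple undirected graph is a \<^locale>\<open>pair_bidirected_digraph\<close>: a vertex set together with
  a symmetric, loop-free set of arcs on it, an undirected edge being a pair of opposite arcs.
  Neither finiteness nor non-emptiness of the vertex set is implied.
\<close>

definition countable_graph :: "'a pair_pre_digraph \<Rightarrow> bool" where
  "countable_graph G \<longleftrightarrow> pair_bidirected_digraph G \<and> countable (pverts G)"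

text \<open>
  In the sense of \<^const>\<open>pre_digraph.cycle\<close>, traversing one edge back and forth is a cycle
  (of length 2), so \<^const>\<open>forest\<close> and \<^const>\<open>tree\<close> are not the undirected notions on a
  symmetric digraph. In a simple graph the undirected cycles are those of length at least 3.
\<close>

definition undirected_forest :: "'a pair_pre_digraph \<Rightarrow> bool" where
  "undirected_forest G \<longleftrightarrow> \<not> (\<exists>p. pre_digraph.cycle (with_proj G) p \<and> 3 \<le> length p)"

definition finite_tree :: "'a pair_pre_digraph \<Rightarrow> bool" where
  "finite_tree T \<longleftrightarrow> pair_graph T \<and> connected (with_proj T) \<and> undirected_forest T"

text \<open>
  For a symmetric digraph without parallel arcs the out-degree is the number of neighbours.
  (It is defined by \<^const>\<open>card\<close>, hence only meaningful at vertices of finite degree.)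
\<close>

definition max_degree :: "'a pair_pre_digraph \<Rightarrow> nat" where
  "max_degree G = Max (out_degree (with_proj G) ` pverts G)"

definition has_subgraph_iso :: "'a pair_pre_digraph \<Rightarrow> 'b pair_pre_digraph \<Rightarrow> bool" where
  "has_subgraph_iso G H \<longleftrightarrow>
     (\<exists>S. subgraph (with_proj S) (with_proj G) \<and> digraph_iso (with_proj H) (with_proj S))"

definition free_of :: "'a pair_pre_digraph \<Rightarrow> 'b pair_pre_digraph \<Rightarrow> bool" where
  "free_of T G \<longleftrightarrow> \<not> has_subgraph_iso G T"

text \<open>
  Every countable graph has an isomorphic copy with vertices in \<^typ>\<open>nat\<close>, so it suffices that
  the graphs to be embedded range over that type; see \<open>weakly_universal_all_types\<close> below.
\<close>

definition weakly_universal :: "'a pair_pre_digraph \<Rightarrow> 'b pair_pre_digraph \<Rightarrow> bool" where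
  "weakly_universal T G \<longleftrightarrow> countable_graph G \<and> free_of T G \<and>
     (\<forall>H :: nat pair_pre_digraph. countable_graph H \<and> free_of T H \<longrightarrow> has_subgraph_iso G H)"

lemma has_subgraph_iso_iff:
  assumes H: "pair_wf_digraph H" and G: "pair_wf_digraph G"
  shows "has_subgraph_iso G H \<longleftrightarrow>
    (\<exists>f. inj_on f (pverts H) \<and> f ` pverts H \<subseteq> pverts G \<and>
         (\<forall>u v. (u, v) \<in> parcs H \<longrightarrow> (f u, f v) \<in> parcs G))" (is "?L \<longleftrightarrow> ?R")
proof
  interpret H: pair_wf_digraph H by (rule H)
  assume ?L
  then obtain S h where S: "subgraph (with_proj S) (with_proj G)"
    and h: "pre_digraph.digraph_isomorphism (with_proj H) h"
    and eq: "with_proj S = app_iso h (with_proj H)"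
    unfolding has_subgraph_iso_def digraph_iso_def by auto
  have "arcs_ends (with_proj S)
      = (\<lambda>(u, v). (iso_verts h u, iso_verts h v)) ` arcs_ends (with_proj H)"
    unfolding eq by (rule wf_digraph.arcs_ends_app_iso_eq[OF H.wf_digraph h])
  moreover have "pverts S = iso_verts h ` pverts H"
    using arg_cong[OF eq, of verts] by simp
  moreover have "inj_on (iso_verts h) (pverts H)"
    using h unfolding pre_digraph.digraph_isomorphism_def by simp
  ultimately show ?R
    using S unfolding subgraph_def by (intro exI[of _ "iso_verts h"]) auto
next
  interpret H: pair_wf_digraph H by (rule H)
  interpret G: pair_wf_digraph G by (rule G)
  assume ?R
  then obtain f where inj: "inj_on f (pverts H)" and fv: "f ` pverts H \<subseteq> pverts G"
    and fa: "\<And>u v. (u, v) \<in> parcs H \<Longrightarrow> (f u, f v) \<in> parcs G" by blast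
  define S where "S = \<lparr>pverts = f ` pverts H, parcs = map_prod f f ` parcs H\<rparr>"
  define h where "h = \<lparr>iso_verts = f, iso_arcs = map_prod f f, iso_head = snd, iso_tail = fst\<rparr>"
  have "inj_on (map_prod f f) (parcs H)"
    by (rule inj_on_subset[OF map_prod_inj_on[OF inj inj]]) (auto dest: H.wellformed')
  then have "pre_digraph.digraph_isomorphism (with_proj H) h"
    using inj H.wf_digraph by (auto simp: pre_digraph.digraph_isomorphism_def h_def)
  moreover have "with_proj S = app_iso h (with_proj H)"
    by (simp add: with_proj_def S_def app_iso_def h_def)
  moreover have "pair_wf_digraph S"
    by unfold_locales (auto simp: S_def dest: H.wellformed')
  then have "subgraph (with_proj S) (with_proj G)"
    using fv fa G.wf_digraph
    by (auto simp: subgraph_def S_def compatible_def with_proj_def wf_digraph_def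
        pair_wf_digraph_def)
  ultimately show ?L unfolding has_subgraph_iso_def digraph_iso_def by blast
qed

lemma weakly_universal_all_types:
  fixes T :: "'a pair_pre_digraph" and G :: "'b pair_pre_digraph" and H :: "'c pair_pre_digraph"
  assumes wu: "weakly_universal T G" and T: "pair_wf_digraph T"
    and H: "countable_graph H" and free: "free_of T H"
  shows "has_subgraph_iso G H"
proof -
  interpret H: pair_bidirected_digraph H using H by (simp add: countable_graph_def)
  have wfH: "pair_wf_digraph H" ..
  interpret G: pair_bidirected_digraph G
    using wu by (simp add: weakly_universal_def countable_graph_def)
  have wfG: "pair_wf_digraph G" ..
  obtain e :: "'c \<Rightarrow> nat" where e: "inj_on e (pverts H)"
    using H by (auto simp: countable_graph_def countable_def)
  define g where "g = the_inv_into (pverts H) e"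
  have g: "\<And>x. x \<in> pverts H \<Longrightarrow> g (e x) = x"
    unfolding g_def by (rule the_inv_into_f_f[OF e])
  define N where "N = \<lparr>pverts = e ` pverts H, parcs = map_prod e e ` parcs H\<rparr>"
  have simple: "pair_bidirected_digraph N"
  proof
    show "symmetric (with_proj N)"
      using H.pair_sym_arcs by (auto simp: symmetric_def N_def intro!: symI dest: symD)
    show "fst a \<noteq> snd a" if a: "a \<in> parcs N" for a
    proof -
      obtain u v where uv: "a = (e u, e v)" "(u, v) \<in> parcs H"
        using a by (auto simp: N_def)
      then have "u \<noteq> v" using H.pair_no_loops[of "(u, v)"] by simp
      with uv show ?thesis using inj_on_eq_iff[OF e] by (auto dest: H.wellformed')
    qed
  qed (auto simp: N_def dest: H.wellformed')
  then interpret N: pair_bidirected_digraph N .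
  have wfN: "pair_wf_digraph N" ..
  have "free_of T N"
    unfolding free_of_def
  proof
    assume "has_subgraph_iso N T"
    then obtain f where f: "inj_on f (pverts T)" "f ` pverts T \<subseteq> pverts N"
      "\<And>u v. (u, v) \<in> parcs T \<Longrightarrow> (f u, f v) \<in> parcs N"
      unfolding has_subgraph_iso_iff[OF T wfN] by blast
    have injg: "inj_on g (pverts N)" by (rule inj_onI) (auto simp: N_def g)
    have gN: "(g u, g v) \<in> parcs H" if "(u, v) \<in> parcs N" for u v
      using that by (auto simp: N_def g H.wellformed')
    have "inj_on (g \<circ> f) (pverts T)"
      using f(1,2) injg by (meson comp_inj_on inj_on_subset)
    moreover have "(g \<circ> f) ` pverts T \<subseteq> pverts H" using f(2) by (auto simp: N_def g)
    ultimately have "has_subgraph_iso H T"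
      unfolding has_subgraph_iso_iff[OF T wfH] using f(3) gN
      by (intro exI[of _ "g \<circ> f"]) auto
    with free show False by (simp add: free_of_def)
  qed
  moreover have "countable_graph N"
    using simple by (simp add: countable_graph_def)
  ultimately have "has_subgraph_iso G N" using wu by (simp add: weakly_universal_def)
  then obtain f where f: "inj_on f (pverts N)" "f ` pverts N \<subseteq> pverts G"
    "\<And>u v. (u, v) \<in> parcs N \<Longrightarrow> (f u, f v) \<in> parcs G"
    unfolding has_subgraph_iso_iff[OF wfN wfG] by blast
  have "inj_on (f \<circ> e) (pverts H)" using f(1) e by (simp add: N_def comp_inj_on)
  then show ?thesis
    unfolding has_subgraph_iso_iff[OF wfH wfG] using f(2,3)
    by (intro exI[of _ "f \<circ> e"]) (force simp: N_def)
qed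

end

theory Submission
  imports Defs
begin

text \<open>
  Let \<open>v0\<close> be the centre of \<open>T\<close>, of degree \<open>d = r + 1\<close>; every other vertex has degree at most
  \<open>r\<close>, and \<open>r \<ge> 3\<close>. A graph of maximum degree \<open>r\<close> is \<open>T\<close>-free.

  Suppose first that a leaf \<open>l\<close> of \<open>T\<close> is adjacent to \<open>v0\<close>. Then an \<open>r\<close>-regular connected graph
  \<open>H\<close> without short cycles is rigid inside every \<open>T\<close>-free graph \<open>G\<close>: a copy of \<open>H\<close> in \<open>G\<close> is
  a connected component of \<open>G\<close>, with no further edges (\<open>no_extra_neighbour\<close>). For suppose that
  the image of a vertex \<open>v\<close> has an additional neighbour \<open>w\<close> in \<open>G\<close>. In \<open>T - l\<close> no vertex has
  degree above \<open>r\<close>, so \<open>T - l\<close> can be laid greedily into \<open>H\<close> with \<open>v0\<close> at \<open>v\<close>; unless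
  \<open>w\<close> lies on the image of this copy, \<open>w\<close> completes it to a copy of \<open>T\<close> as the image of \<open>l\<close>.
  If \<open>w\<close> does lie on it, it comes from a vertex \<open>u\<close> joined to \<open>v\<close> by a short path in \<open>H\<close>
  that starts \<open>v, x, \<dots>\<close>. Then one branch of \<open>T\<close> is laid out from \<open>u\<close> away from that path,
  using the new edge from \<open>v\<close> to \<open>u\<close>, and \<open>x\<close> becomes free to be the image of \<open>l\<close>.

  There are too many such graphs \<open>H\<close>. For every set \<open>A\<close> of large numbers, a ray with a chord that
  closes a cycle of length \<open>n\<close> for each \<open>n \<in> A\<close>, completed to an \<open>r\<close>-regular graph by infinite
  trees, is connected and its cycles have exactly the lengths in \<open>A\<close> (this needs \<open>r \<ge> 3\<close>).
  Countably many components of \<open>G\<close> cannot realise all sets \<open>A\<close>; a diagonal choice of \<open>A\<close> gives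
  the contradiction (\<open>not_universal_of_leaf_at_centre\<close>).

  If no leaf is adjacent to \<open>v0\<close>, let \<open>T'\<close> be \<open>T\<close> without its leaves. The degree of \<open>v0\<close> is the
  same in \<open>T'\<close>, so \<open>T'\<close> again has a unique vertex of maximal degree \<open>d\<close>. From a weakly universal
  \<open>T\<close>-free graph one gets a weakly universal \<open>T'\<close>-free graph by keeping only the vertices of
  infinite degree (\<open>weakly_universal_prune\<close>), and induction on the size of \<open>T\<close> finishes the
  proof.
\<close>

section \<open>Connected sets and cycles\<close>

definition connected_in :: "('a \<times> 'a) set \<Rightarrow> 'a set \<Rightarrow> bool" where
  "connected_in E W \<longleftrightarrow> (\<forall>a\<in>W. \<forall>b\<in>W. (a, b) \<in> (Restr E W)\<^sup>*)"

definition is_cycle :: "('a \<times> 'a) set \<Rightarrow> 'a list \<Rightarrow> bool" where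
  "is_cycle E xs \<longleftrightarrow> distinct xs \<and> 3 \<le> length xs \<and>
     successively (\<lambda>x y. (x, y) \<in> E) xs \<and> (last xs, hd xs) \<in> E"

text \<open>
  A finite graph has a cycle iff some nonempty set of vertices induces a subgraph of minimum degree
  at least two. This form makes no reference to a walk, and it is the one in which the absence of
  short cycles is assumed and in which the cycles of a concrete graph are determined.
\<close>

definition cyclic_set :: "('a \<times> 'a) set \<Rightarrow> 'a set \<Rightarrow> bool" where
  "cyclic_set E C \<longleftrightarrow> finite C \<and> C \<noteq> {} \<and>
     (\<forall>x\<in>C. \<exists>y\<in>C. \<exists>z\<in>C. y \<noteq> z \<and> (x, y) \<in> E \<and> (x, z) \<in> E)"

lemma rtrancl_imp_distinct_path:
  assumes "(a, b) \<in> R\<^sup>*"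
  shows "\<exists>xs. xs \<noteq> [] \<and> hd xs = a \<and> last xs = b \<and> distinct xs \<and> successively (\<lambda>x y. (x, y) \<in> R) xs"
  using assms
proof (induction rule: converse_rtrancl_induct)
  case base
  show ?case by (rule exI[of _ "[b]"]) simp
next
  case (step a y)
  then obtain xs where xs: "xs \<noteq> []" "hd xs = y" "last xs = b" "distinct xs"
    "successively (\<lambda>x y. (x, y) \<in> R) xs" by blast
  show ?case
  proof (cases "a \<in> set xs")
    case False
    with xs step.hyps show ?thesis
      by (intro exI[of _ "a # xs"]) (auto simp: successively_Cons)
  next
    case True
    then obtain ys zs where "xs = ys @ a # zs" by (meson split_list)
    with xs show ?thesis
      by (intro exI[of _ "a # zs"]) (auto simp: successively_append_iff)
  qed
qed

lemma successively_Restr: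
  assumes "successively (\<lambda>x y. (x, y) \<in> Restr E W) xs" "xs \<noteq> []" "hd xs \<in> W"
  shows "set xs \<subseteq> W" "successively (\<lambda>x y. (x, y) \<in> E) xs"
  using assms by (induction xs rule: induct_list012) auto

lemma connected_in_path:
  assumes "connected_in E W" "a \<in> W" "b \<in> W"
  obtains xs where "xs \<noteq> []" "hd xs = a" "last xs = b" "distinct xs" "set xs \<subseteq> W"
    "successively (\<lambda>x y. (x, y) \<in> E) xs"
proof -
  have "(a, b) \<in> (Restr E W)\<^sup>*" using assms by (simp add: connected_in_def)
  from rtrancl_imp_distinct_path[OF this] assms(2) successively_Restr[of E W] that
  show ?thesis by metis
qed

lemma connected_in_sing [simp]: "connected_in E {a}"
  by (simp add: connected_in_def)

lemma rtrancl_Restr_mono: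
  assumes "(a, b) \<in> (Restr E W)\<^sup>*" "W \<subseteq> W'"
  shows "(a, b) \<in> (Restr E W')\<^sup>*"
  using assms rtrancl_mono[of "Restr E W" "Restr E W'"] by blast

lemma connected_in_insert:
  assumes E: "sym E" and W: "connected_in E W" and p: "p \<in> W" "(p, z) \<in> E"
  shows "connected_in E (insert z W)"
proof -
  let ?R = "Restr E (insert z W)"
  have old: "(a, b) \<in> ?R\<^sup>*" if "a \<in> W" "b \<in> W" for a b
    using W that rtrancl_Restr_mono[of a b E W "insert z W"] by (auto simp: connected_in_def)
  have pz: "(p, z) \<in> ?R" "(z, p) \<in> ?R" using p E by (auto dest: symD)
  have to: "(a, p) \<in> ?R\<^sup>*" if "a \<in> insert z W" for a
    using that old p(1) pz(2) by auto
  have from': "(p, b) \<in> ?R\<^sup>*" if "b \<in> insert z W" for b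
    using that old p(1) pz(1) by auto
  show ?thesis unfolding connected_in_def using to from' by (meson rtrancl_trans)
qed

lemma connected_in_path_set:
  assumes E: "sym E"
  shows "successively (\<lambda>x y. (x, y) \<in> E) xs \<Longrightarrow> connected_in E (set xs)"
proof (induction xs rule: induct_list012)
  case (3 x y zs)
  then have "connected_in E (insert x (set (y # zs)))"
    by (intro connected_in_insert[OF E, where p = y]) (use E in \<open>auto dest: symD\<close>)
  then show ?case by simp
qed (auto simp: connected_in_def)

text \<open>
  A connected set can be exhausted by adding one adjacent vertex at a time.
\<close>

lemma connected_in_leave:
  assumes "connected_in E V" "S \<subseteq> V" "S \<noteq> {}" "S \<noteq> V"
  obtains p z where "p \<in> S" "z \<in> V" "z \<notin> S" "(p, z) \<in> E"
proof -
  obtain a b where ab: "a \<in> S" "b \<in> V" "b \<notin> S" using assms by blast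
  then have "(a, b) \<in> (Restr E V)\<^sup>*" using assms by (auto simp: connected_in_def)
  then have "\<exists>p z. p \<in> S \<and> z \<in> V \<and> z \<notin> S \<and> (p, z) \<in> E"
    using ab(1,3)
    by (induction rule: rtrancl_induct) auto
  with that show ?thesis by blast
qed

text \<open>
  A path inside \<open>W\<close> between the two neighbours is closed up by \<open>h\<close>. In acyclic surroundings a new
  vertex is therefore attached to a connected set by a single edge; the greedy construction rests
  on this.
\<close>

lemma two_neighbours_cycle:
  assumes E: "sym E" and W: "connected_in E W" and h: "h \<notin> W"
    and ab: "a \<in> W" "b \<in> W" "a \<noteq> b" "(h, a) \<in> E" "(h, b) \<in> E"
  obtains xs where "is_cycle E xs" "set xs \<subseteq> insert h W"
proof -
  obtain xs where xs: "xs \<noteq> []" "hd xs = a" "last xs = b" "distinct xs" "set xs \<subseteq> W"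
    "successively (\<lambda>x y. (x, y) \<in> E) xs"
    using connected_in_path[OF W ab(1,2)] by blast
  have "2 \<le> length xs"
    using xs(1-3) ab(3) by (cases xs rule: remdups_adj.cases) auto
  moreover have "(b, h) \<in> E" using ab(5) E by (auto dest: symD)
  ultimately have "is_cycle E (h # xs)"
    using xs ab h by (auto simp: is_cycle_def successively_Cons)
  with xs(5) show ?thesis by (intro that[of "h # xs"]) auto
qed

lemma is_cycle_cyclic_set:
  assumes E: "sym E" and c: "is_cycle E xs"
  shows "cyclic_set E (set xs)"
proof -
  let ?n = "length xs"
  have n: "3 \<le> ?n" and d: "distinct xs" using c by (auto simp: is_cycle_def)
  have suc: "(xs ! i, xs ! Suc i) \<in> E" if "Suc i < ?n" for i
    using c that by (auto simp: is_cycle_def successively_conv_nth)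
  have close: "(xs ! (?n - 1), xs ! 0) \<in> E"
  proof -
    have "xs \<noteq> []" using n by auto
    then show ?thesis using c by (simp add: is_cycle_def last_conv_nth hd_conv_nth)
  qed
  note sy = symD[OF E]
  have "\<exists>y\<in>set xs. \<exists>z\<in>set xs. y \<noteq> z \<and> (xs ! i, y) \<in> E \<and> (xs ! i, z) \<in> E" if i: "i < ?n" for i
  proof -
    define j where "j = (if i = 0 then ?n - 1 else i - 1)"
    define k where "k = (if i = ?n - 1 then 0 else Suc i)"
    have "(xs ! i, xs ! j) \<in> E" "(xs ! i, xs ! k) \<in> E"
      using suc[of "i - 1"] suc[of i] close i sy by (auto simp: j_def k_def)
    moreover have "j < ?n" "k < ?n" "j \<noteq> k" using i n by (auto simp: j_def k_def)
    moreover have "xs ! j \<noteq> xs ! k" using calculation d by (simp add: nth_eq_iff_index_eq)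
    ultimately show ?thesis by (meson nth_mem)
  qed
  then show ?thesis using n unfolding cyclic_set_def by (auto simp: in_set_conv_nth)
qed

lemma connected_in_Restr: "V \<subseteq> U \<Longrightarrow> connected_in (Restr E U) V = connected_in E V"
proof -
  assume "V \<subseteq> U"
  then have "Restr (Restr E U) V = Restr E V" by blast
  then show ?thesis by (simp add: connected_in_def)
qed

text \<open>
  A walk that enters a vertex of degree one has to return to where it came from, so the excursion
  can be cut out.
\<close>

lemma connected_in_remove_leaves:
  assumes E: "sym E" "connected_in E V" and X: "\<And>x. x \<in> X \<Longrightarrow> \<exists>p. E `` {x} \<subseteq> {p}"
  shows "connected_in E (V - X)"
  unfolding connected_in_def
proof (intro ballI)
  fix a b assume a: "a \<in> V - X" and b: "b \<in> V - X"
  let ?R = "Restr E (V - X)"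
  have "(a, b) \<in> (Restr E V)\<^sup>*" using a b E(2) by (auto simp: connected_in_def)
  \<comment> \<open>If the walk is at a removed vertex, the invariant records the walk up to its only neighbour.\<close>
  then have "(b \<notin> X \<longrightarrow> (a, b) \<in> ?R\<^sup>*) \<and>
    (b \<in> X \<longrightarrow> (\<exists>p. p \<in> V - X \<and> E `` {b} \<subseteq> {p} \<and> (a, p) \<in> ?R\<^sup>*))"
  proof (induction rule: rtrancl_induct)
    case base
    then show ?case using a by simp
  next
    case (step y z)
    have yz: "(y, z) \<in> E" "y \<in> V" "z \<in> V" using step.hyps by auto
    have zy: "(z, y) \<in> E" using symD[OF E(1) yz(1)] .
    show ?case
    proof (cases "y \<in> X")
      case True
      then obtain p where p: "p \<in> V - X" "E `` {y} \<subseteq> {p}" "(a, p) \<in> ?R\<^sup>*"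
        using step.IH by blast
      then have "z = p" using yz by blast
      with p show ?thesis by simp
    next
      case False
      then have ay: "(a, y) \<in> ?R\<^sup>*" using step.IH by simp
      show ?thesis
      proof (cases "z \<in> X")
        case True
        then obtain p where "E `` {z} \<subseteq> {p}" using X by blast
        then have "E `` {z} \<subseteq> {y}" using zy by blast
        then show ?thesis using ay yz False True by blast
      next
        case zX: False
        then have "(y, z) \<in> ?R" using yz False by simp
        with ay have "(a, z) \<in> ?R\<^sup>*" by (rule rtrancl_into_rtrancl)
        with zX show ?thesis by simp
      qed
    qed
  qed
  then show "(a, b) \<in> ?R\<^sup>*" using b by simp
qed

section \<open>Finite trees\<close>

definition tree_on :: "'a set \<Rightarrow> ('a \<times> 'a) set \<Rightarrow> bool" where
  "tree_on V E \<longleftrightarrow> finite V \<and> E \<subseteq> V \<times> V \<and> sym E \<and> irrefl E \<and> connected_in E V \<and>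
     (\<nexists>xs. is_cycle E xs)"

lemma is_cycle_mono: "is_cycle E xs \<Longrightarrow> E \<subseteq> E' \<Longrightarrow> is_cycle E' xs"
  by (auto simp: is_cycle_def elim: successively_mono)

lemma tree_on_remove_leaves:
  assumes T: "tree_on V E" and X: "\<And>x. x \<in> X \<Longrightarrow> \<exists>p. E `` {x} \<subseteq> {p}"
  shows "tree_on (V - X) (Restr E (V - X))"
proof -
  have "connected_in (Restr E (V - X)) (V - X)"
    using connected_in_remove_leaves[of E V X] T X by (simp add: tree_on_def connected_in_Restr)
  moreover have "\<not> is_cycle (Restr E (V - X)) xs" for xs
    using T is_cycle_mono[of "Restr E (V - X)" xs E] by (auto simp: tree_on_def)
  ultimately show ?thesis using T
    by (auto simp: tree_on_def irrefl_def sym_def)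
qed

text \<open>
  Grow a connected set vertex by vertex until one vertex \<open>z\<close> is missing. Only one edge leads from
  \<open>z\<close> to the rest.
\<close>

lemma tree_has_leaf:
  assumes T: "tree_on V E" and V: "V \<noteq> {}"
  shows "\<exists>x\<in>V. \<exists>p. E `` {x} \<subseteq> {p}"
proof -
  have fin: "finite V" and arcs: "E \<subseteq> V \<times> V" and sym: "sym E" and irr: "irrefl E"
    and conn: "connected_in E V" and acyc: "\<nexists>xs. is_cycle E xs"
    using T by (auto simp: tree_on_def)
  obtain a where a: "a \<in> V" using V by blast
  show ?thesis
  proof (cases "V = {a}")
    case True
    then have "E `` {a} \<subseteq> {a}" using arcs by auto
    with a show ?thesis by blast
  next
    case False
    define F where "F = {S. S \<subset> V \<and> S \<noteq> {} \<and> connected_in E S}"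
    have "finite F" using fin by (auto simp: F_def intro: finite_subset[of _ "Pow V"])
    moreover have "{a} \<in> F" using a False by (auto simp: F_def)
    ultimately obtain S where S: "S \<in> F" "\<And>S'. S' \<in> F \<Longrightarrow> S \<subseteq> S' \<Longrightarrow> S = S'"
      using finite_has_maximal2 by metis
    have SV: "S \<subseteq> V" "S \<noteq> {}" "S \<noteq> V" "connected_in E S" using S(1) by (auto simp: F_def)
    obtain p z where pz: "p \<in> S" "z \<in> V" "z \<notin> S" "(p, z) \<in> E"
      using connected_in_leave[OF conn SV(1-3)] by blast
    have "connected_in E (insert z S)" by (rule connected_in_insert[OF sym SV(4) pz(1,4)])
    then have "insert z S = V" using S(2)[of "insert z S"] SV pz by (auto simp: F_def)
    moreover have "q = p" if "q \<in> S" "(z, q) \<in> E" for q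
      using two_neighbours_cycle[OF sym SV(4) pz(3) that(1) pz(1) _ that(2) symD[OF sym pz(4)]] acyc
      by blast
    ultimately have "E `` {z} \<subseteq> {p}" using arcs irr by (auto simp: irrefl_def)
    with pz(2) show ?thesis by blast
  qed
qed

text \<open>
  Translates a list of vertices, closed up by a last vertex \<open>e\<close>, into the list of its arcs.
\<close>

lemma awalk_of_vertex_list:
  "pcas x (zip (x # xs) (xs @ [e])) e \<and> pawalk_verts x (zip (x # xs) (xs @ [e])) = x # xs @ [e] \<and>
   (successively (\<lambda>x y. (x, y) \<in> E) (x # xs @ [e]) \<longrightarrow> set (zip (x # xs) (xs @ [e])) \<subseteq> E)"
  by (induction xs arbitrary: x) auto

lemma undirected_forest_no_cycle:
  assumes wf: "pair_wf_digraph T" and F: "undirected_forest T"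
  shows "\<not> is_cycle (parcs T) xs"
proof
  assume c: "is_cycle (parcs T) xs"
  then obtain x ys where xs: "xs = x # ys" by (cases xs) (auto simp: is_cycle_def)
  let ?p = "zip (x # ys) (ys @ [x])"
  have suc: "successively (\<lambda>x y. (x, y) \<in> parcs T) (xs @ [x])"
    using c unfolding is_cycle_def successively_append_iff by (simp add: xs)
  have w: "pcas x ?p x" "pawalk_verts x ?p = x # ys @ [x]" "set ?p \<subseteq> parcs T"
    using awalk_of_vertex_list[of x ys x "parcs T"] suc by (auto simp: xs)
  have "(x, hd (ys @ [x])) \<in> parcs T" using w(3) by (cases ys) auto
  then have "x \<in> pverts T" using pair_wf_digraph.in_arcsD1[OF wf] by blast
  then have "pre_digraph.cycle (with_proj T) ?p"
    using w c unfolding pre_digraph.cycle_def pre_digraph.awalk_def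
    by (auto simp: cas_with_proj_eq awalk_verts_with_proj_eq is_cycle_def xs intro!: exI[of _ x])
  moreover have "3 \<le> length ?p" using c by (simp add: is_cycle_def xs)
  ultimately show False using F by (auto simp: undirected_forest_def)
qed

lemma finite_tree_imp_tree_on:
  assumes "finite_tree T"
  shows "tree_on (pverts T) (parcs T)"
proof -
  have pg: "pair_graph T" and conn: "connected (with_proj T)" and F: "undirected_forest T"
    using assms by (auto simp: finite_tree_def)
  interpret pair_graph T by (rule pg)
  have arcs: "parcs T \<subseteq> pverts T \<times> pverts T" by (auto dest: wellformed')
  then have R: "Restr (parcs T) (pverts T) = parcs T" by blast
  have "strongly_connected (with_proj T)"
    using conn pair_sym_arcs symmetric_connected_imp_strongly_connected by blast
  then have "(u, v) \<in> (parcs T)\<^sup>*" if "u \<in> pverts T" "v \<in> pverts T" for u v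
    using that reachable_rtranclI[of "with_proj T" u v] by (auto simp: strongly_connected_def)
  then have "connected_in (parcs T) (pverts T)" by (simp add: connected_in_def R)
  moreover have "sym (parcs T)" using pair_sym_arcs by (simp add: symmetric_def)
  moreover have "irrefl (parcs T)" by (rule irreflI) (use pair_no_loops in force)
  moreover have "\<not> is_cycle (parcs T) xs" for xs
    by (rule undirected_forest_no_cycle[OF _ F]) unfold_locales
  ultimately show ?thesis using arcs pair_finite_verts by (simp add: tree_on_def)
qed

section \<open>Trees inside regular graphs without short cycles\<close>

text \<open>
  A cyclic set contains the vertex set of a cycle and cycles are cyclic sets, so the last assumption
  says that all cycles are longer than \<open>N\<close>.
\<close>

locale regular_graph_of_large_girth =
  fixes V :: "'v set" and E :: "('v \<times> 'v) set" and r N :: nat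
  assumes arcs: "E \<subseteq> V \<times> V" and sym: "sym E" and irrefl: "irrefl E"
    and finite_nbrs: "\<And>x. x \<in> V \<Longrightarrow> finite (E `` {x})"
    and regular: "\<And>x. x \<in> V \<Longrightarrow> card (E `` {x}) = r"
    and girth: "\<And>C. cyclic_set E C \<Longrightarrow> N < card C"
begin

text \<open>
  The local form of acyclicity: the cycle that two neighbours would create has at most
  \<open>card W + 1 \<le> N\<close> vertices.
\<close>

lemma unique_neighbour:
  assumes W: "connected_in E W" "finite W" "card W < N" and h: "h \<notin> W"
    and ab: "a \<in> W" "b \<in> W" "(h, a) \<in> E" "(h, b) \<in> E"
  shows "a = b"
proof (rule ccontr)
  assume "a \<noteq> b"
  then obtain xs where xs: "is_cycle E xs" "set xs \<subseteq> insert h W"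
    using two_neighbours_cycle[OF sym W(1) h] ab by blast
  have "N < card (set xs)" using girth is_cycle_cyclic_set[OF sym xs(1)] by blast
  also have "\<dots> \<le> card (insert h W)" using xs(2) W(2) by (intro card_mono) auto
  also have "\<dots> \<le> Suc (card W)" using W(2) by (simp add: card_insert_if)
  finally show False using W(3) by simp
qed

text \<open>
  The tree is laid out vertex by vertex. If \<open>z\<close> is to be attached to \<open>p\<close>, the image of \<open>p\<close> has
  \<open>r\<close> neighbours, of which fewer than \<open>r\<close> are occupied, because \<open>p\<close> still lacks the neighbour
  \<open>z\<close> in \<open>S\<close>. The new image has no second neighbour in the occupied set, as the girth is large, so
  the count of occupied neighbours stays bounded by the degree already used in the tree.

  The set \<open>W\<close> may be larger than the image of \<open>S\<close>, and edges inside \<open>S\<close> need not go to edges.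
  This allows the construction to start from a path of which only the end points are used, the
  edge between them being supplied from outside the regular graph.
\<close>

lemma greedy_embedding:
  fixes VT :: "'t set" and ET :: "('t \<times> 't) set"
  assumes T: "tree_on VT ET" and deg: "\<And>p. p \<in> VT \<Longrightarrow> card (ET `` {p}) \<le> r"
    and S: "S \<subseteq> VT" "S \<noteq> {}" "connected_in ET S"
    and W: "W \<subseteq> V" "finite W" "connected_in E W"
    and \<phi>: "inj_on \<phi> S" "\<phi> ` S \<subseteq> W"
    and room: "\<And>p. p \<in> S \<Longrightarrow> card (E `` {\<phi> p} \<inter> W) \<le> card (ET `` {p} \<inter> S)"
    and size: "card W + card (VT - S) \<le> N"
  shows "\<exists>\<psi>. (\<forall>p\<in>S. \<psi> p = \<phi> p) \<and> inj_on \<psi> VT \<and> \<psi> ` VT \<subseteq> V \<and> \<psi> ` (VT - S) \<inter> W = {} \<and>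
     (\<forall>p q. (p, q) \<in> ET \<longrightarrow> \<not> (p \<in> S \<and> q \<in> S) \<longrightarrow> (\<psi> p, \<psi> q) \<in> E) \<and> connected_in E (W \<union> \<psi> ` VT)"
  using S W \<phi> room size
proof (induction "card (VT - S)" arbitrary: S W \<phi>)
  case 0
  have "finite VT" using T by (simp add: tree_on_def)
  with 0 have "S = VT" by auto
  with 0 T have "W \<union> \<phi> ` VT = W" "\<phi> ` VT \<subseteq> V" by auto
  with 0 \<open>S = VT\<close> show ?case using T
    by (intro exI[of _ \<phi>]) (auto simp: tree_on_def)
next
  case (Suc n)
  have finT: "finite VT" and symT: "sym ET" and irrT: "irrefl ET" and arcsT: "ET \<subseteq> VT \<times> VT"
    and connT: "connected_in ET VT" and acycT: "\<nexists>xs. is_cycle ET xs"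
    using T by (auto simp: tree_on_def)
  have "S \<noteq> VT" using Suc.hyps by auto
  then obtain p z where pz: "p \<in> S" "z \<in> VT" "z \<notin> S" "(p, z) \<in> ET"
    using connected_in_leave[OF connT Suc.prems(1,2)] by blast
  have zp: "(z, p) \<in> ET" using pz symD[OF symT] by blast
  have only: "q = p" if "q \<in> S" "(z, q) \<in> ET" for q
    using two_neighbours_cycle[OF symT Suc.prems(3) pz(3) that(1) pz(1) _ that(2) zp] acycT
    by blast
  have pV: "\<phi> p \<in> V" "\<phi> p \<in> W" using pz Suc.prems by auto
  have fin: "finite (ET `` {q})" for q
    using finite_subset[of "ET `` {q}" VT] arcsT finT by auto
  have "card (E `` {\<phi> p} \<inter> W) \<le> card (ET `` {p} \<inter> S)" using Suc.prems pz by blast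
  also have "\<dots> < card (ET `` {p})" by (rule psubset_card_mono[OF fin]) (use pz in auto)
  also have "\<dots> \<le> r" using deg pz Suc.prems by blast
  also have "r = card (E `` {\<phi> p})" using regular pV by simp
  finally have "E `` {\<phi> p} \<inter> W \<noteq> E `` {\<phi> p}" by auto
  then obtain h where h: "(\<phi> p, h) \<in> E" "h \<notin> W" by blast
  have hp: "(h, \<phi> p) \<in> E" using h symD[OF sym] by blast
  have hV: "h \<in> V" using h arcs by auto
  define S' where "S' = insert z S"
  define W' where "W' = insert h W"
  define \<phi>' where "\<phi>' = \<phi>(z := h)"
  have keep: "\<phi>' q = \<phi> q" if "q \<in> S" for q using that pz by (auto simp: \<phi>'_def)
  have VS: "VT - S = insert z (VT - S')" "z \<notin> VT - S'" using pz by (auto simp: S'_def)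
  then have cardVS: "card (VT - S) = Suc (card (VT - S'))" using finT by simp
  have cW: "card W < N" using Suc.prems(10) Suc.hyps(2) by simp
  have onlyh: "w = \<phi> p" if "w \<in> W" "(h, w) \<in> E" for w
    using unique_neighbour[OF Suc.prems(6,5) cW h(2) that(1) pV(2) that(2) hp] .
  have "\<exists>\<psi>. (\<forall>p\<in>S'. \<psi> p = \<phi>' p) \<and> inj_on \<psi> VT \<and> \<psi> ` VT \<subseteq> V \<and> \<psi> ` (VT - S') \<inter> W' = {} \<and>
     (\<forall>p q. (p, q) \<in> ET \<longrightarrow> \<not> (p \<in> S' \<and> q \<in> S') \<longrightarrow> (\<psi> p, \<psi> q) \<in> E) \<and> connected_in E (W' \<union> \<psi> ` VT)" (is "\<exists>\<psi>. ?P \<psi>")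
  proof (rule Suc.hyps(1))
    show "n = card (VT - S')" using Suc.hyps(2) cardVS by simp
    show "S' \<subseteq> VT" "S' \<noteq> {}" using Suc.prems pz by (auto simp: S'_def)
    show "connected_in ET S'" unfolding S'_def
      by (rule connected_in_insert[OF symT Suc.prems(3) pz(1,4)])
    show "W' \<subseteq> V" "finite W'" using Suc.prems hV by (auto simp: W'_def)
    show "connected_in E W'" unfolding W'_def
      by (rule connected_in_insert[OF sym Suc.prems(6) pV(2) h(1)])
    show "inj_on \<phi>' S'" using Suc.prems(7,8) h pz
      by (auto simp: S'_def \<phi>'_def inj_on_def)
    show "\<phi>' ` S' \<subseteq> W'" using Suc.prems(8) by (auto simp: S'_def W'_def \<phi>'_def)
    show "card W' + card (VT - S') \<le> N"
      using Suc.prems(5,10) h cardVS by (simp add: W'_def)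
    fix q assume q: "q \<in> S'"
    show "card (E `` {\<phi>' q} \<inter> W') \<le> card (ET `` {q} \<inter> S')"
    proof (cases "q = z")
      case True
      have "E `` {\<phi>' q} \<inter> W' \<subseteq> {\<phi> p}"
        using True onlyh irrefl by (auto simp: \<phi>'_def W'_def irrefl_def)
      then have "card (E `` {\<phi>' q} \<inter> W') \<le> 1" using card_mono[of "{\<phi> p}"] by simp
      also have "1 \<le> card (ET `` {q} \<inter> S')"
        using True zp pz fin by (auto simp: S'_def Suc_le_eq card_gt_0_iff)
      finally show ?thesis .
    next
      case False
      then have qS: "q \<in> S" using q by (simp add: S'_def)
      then have \<phi>q: "\<phi>' q = \<phi> q" by (rule keep)
      show ?thesis
      proof (cases "q = p")
        case True
        have "E `` {\<phi> p} \<inter> W' = insert h (E `` {\<phi> p} \<inter> W)" using h by (auto simp: W'_def)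
        then have "card (E `` {\<phi>' q} \<inter> W') = Suc (card (E `` {\<phi> p} \<inter> W))"
          using Suc.prems(5) h(2) \<phi>q True by simp
        also have "\<dots> \<le> Suc (card (ET `` {p} \<inter> S))" using Suc.prems(9)[OF pz(1)] by simp
        also have "\<dots> = card (insert z (ET `` {p} \<inter> S))" using fin pz(3) by simp
        also have "insert z (ET `` {p} \<inter> S) = ET `` {q} \<inter> S'"
          using pz True by (auto simp: S'_def)
        finally show ?thesis .
      next
        case False
        then have "\<phi> q \<noteq> \<phi> p" using Suc.prems(7) qS pz(1) by (auto dest: inj_onD)
        moreover have "\<phi> q \<in> W" using qS Suc.prems(8) by auto
        ultimately have "(\<phi> q, h) \<notin> E" using onlyh symD[OF sym] by blast
        then have "E `` {\<phi>' q} \<inter> W' = E `` {\<phi> q} \<inter> W" using \<phi>q by (auto simp: W'_def)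
        then have "card (E `` {\<phi>' q} \<inter> W') \<le> card (ET `` {q} \<inter> S)"
          using Suc.prems(9) qS by simp
        also have "\<dots> \<le> card (ET `` {q} \<inter> S')"
          using fin by (intro card_mono) (auto simp: S'_def)
        finally show ?thesis .
      qed
    qed
  qed
  then obtain \<psi> where P: "?P \<psi>" by (rule exE)
  from P have \<psi>: "\<And>p. p \<in> S' \<Longrightarrow> \<psi> p = \<phi>' p" "inj_on \<psi> VT" "\<psi> ` VT \<subseteq> V"
      "\<psi> ` (VT - S') \<inter> W' = {}" "connected_in E (W' \<union> \<psi> ` VT)"
    by simp_all
  from P have edge: "(\<psi> a, \<psi> b) \<in> E" if "(a, b) \<in> ET" "\<not> (a \<in> S' \<and> b \<in> S')" for a b
    using that by simp
  have \<psi>z: "\<psi> z = h" using \<psi>(1)[of z] by (simp add: S'_def \<phi>'_def)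
  have \<psi>S: "\<psi> q = \<phi> q" if "q \<in> S" for q using \<psi>(1)[of q] that keep by (simp add: S'_def)
  show ?case
  proof (intro exI[of _ \<psi>] conjI ballI allI)
    show "\<psi> ` (VT - S) \<inter> W = {}" using \<psi>(4) \<psi>z h(2) VS(1) by (auto simp: W'_def)
    have "h \<in> \<psi> ` VT" using \<psi>z pz(2) by blast
    then have "W' \<union> \<psi> ` VT = W \<union> \<psi> ` VT" by (auto simp: W'_def)
    with \<psi>(5) show "connected_in E (W \<union> \<psi> ` VT)" by simp
    fix a b
    show "(a, b) \<in> ET \<longrightarrow> \<not> (a \<in> S \<and> b \<in> S) \<longrightarrow> (\<psi> a, \<psi> b) \<in> E"
    proof (intro impI)
      assume ab: "(a, b) \<in> ET" "\<not> (a \<in> S \<and> b \<in> S)"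
      show "(\<psi> a, \<psi> b) \<in> E"
      proof (cases "a \<in> S' \<and> b \<in> S'")
        case False
        with edge ab(1) show ?thesis by blast
      next
        case True
        then consider "a = z" "b \<in> S" | "b = z" "a \<in> S" | "a = z" "b = z"
          using ab(2) by (auto simp: S'_def)
        then show ?thesis
        proof cases
          case 1
          then have "b = p" using only ab(1) by blast
          then show ?thesis using 1 \<psi>z \<psi>S hp by simp
        next
          case 2
          then have "a = p" using only symD[OF symT ab(1)] by blast
          then show ?thesis using 2 \<psi>z \<psi>S h(1) by simp
        next
          case 3
          then show ?thesis using ab(1) irrT by (auto simp: irrefl_def)
        qed
      qed
    qed
  qed (use \<psi>(2,3) \<psi>S in blast)+
qed

text \<open>
  An additional edge at the copy of the regular graph would create the forbidden tree. A first greedy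
  copy of the tree without \<open>l\<close> is completed by that edge unless the edge leads to a vertex of the
  copy itself; then a second copy is built around the path to that vertex. Both stay within the girth bound because they use at
  most \<open>2 * card VT\<close> vertices.
\<close>

lemma no_extra_neighbour:
  fixes VT :: "'t set" and ET :: "('t \<times> 't) set" and EG :: "('g \<times> 'g) set" and f :: "'v \<Rightarrow> 'g"
  assumes T: "tree_on VT ET" and v0: "card (ET `` {v0}) = Suc r"
    and others: "\<And>p. p \<in> VT \<Longrightarrow> p \<noteq> v0 \<Longrightarrow> card (ET `` {p}) \<le> r"
    and l: "(v0, l) \<in> ET" "ET `` {l} = {v0}"
    and N: "2 * card VT \<le> N" and r: "0 < r"
    and EG: "sym EG" "irrefl EG"
    and f: "inj_on f V" "\<And>x y. (x, y) \<in> E \<Longrightarrow> (f x, f y) \<in> EG"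
    and free: "\<nexists>g. inj_on g VT \<and> (\<forall>p q. (p, q) \<in> ET \<longrightarrow> (g p, g q) \<in> EG)"
    and w: "v \<in> V" "(f v, w) \<in> EG"
  shows "w \<in> f ` (E `` {v})"
proof (rule ccontr)
  assume contra: "w \<notin> f ` (E `` {v})"
  have finT: "finite VT" and symT: "sym ET" and irrT: "irrefl ET" and arcsT: "ET \<subseteq> VT \<times> VT"
    using T by (auto simp: tree_on_def)
  define V1 where "V1 = VT - {l}"
  define E1 where "E1 = Restr ET V1"
  have lV: "l \<in> VT" "v0 \<in> VT" "l \<noteq> v0" using l arcsT irrT by (auto simp: irrefl_def)
  have v0V1: "v0 \<in> V1" using lV by (simp add: V1_def)
  have T1: "tree_on V1 E1" unfolding V1_def E1_def
    by (rule tree_on_remove_leaves[OF T]) (use l in auto)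
  have finV1: "finite V1" using finT by (simp add: V1_def)
  have cardV1: "card VT = Suc (card V1)"
    using card_Suc_Diff1[OF finT lV(1)] by (simp add: V1_def)
  have fin: "finite (ET `` {q})" for q
    using finite_subset[of "ET `` {q}" VT] arcsT finT by auto
  have nb1: "E1 `` {p} = ET `` {p} - {l}" if "p \<in> V1" for p
    using that arcsT by (auto simp: E1_def V1_def)
  have deg_v0: "card (E1 `` {v0}) = r" using nb1[OF v0V1] v0 l fin by simp
  have deg1: "card (E1 `` {p}) \<le> r" if p: "p \<in> V1" for p
  proof (cases "p = v0")
    case False
    have "card (E1 `` {p}) \<le> card (ET `` {p})"
      using nb1[OF p] fin by (intro card_mono) auto
    then show ?thesis using others[of p] p False by (simp add: V1_def)
  qed (use deg_v0 in simp)
  \<comment> \<open>Whatever copy of the tree without \<open>l\<close> is found with its centre at \<open>v\<close>, all neighbours of the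
    image of \<open>v\<close> must be occupied, since a free one would serve as the image of \<open>l\<close>.\<close>
  have no_copy: False
    if \<phi>: "inj_on \<phi> V1" "\<phi> ` V1 \<subseteq> V" "\<phi> v0 = v"
      and edge: "\<And>p q. (p, q) \<in> E1 \<Longrightarrow> (f (\<phi> p), f (\<phi> q)) \<in> EG"
      and y: "(f v, y) \<in> EG" "y \<notin> f ` \<phi> ` V1" for \<phi> y
  proof -
    define g where "g p = (if p = l then y else f (\<phi> p))" for p
    have "inj_on (\<lambda>p. f (\<phi> p)) V1"
      using comp_inj_on[OF \<phi>(1) inj_on_subset[OF f(1) \<phi>(2)]] by (simp add: comp_def)
    then have "inj_on g VT" using y(2) by (auto simp: inj_on_def g_def V1_def image_iff)
    moreover have "(g p, g q) \<in> EG" if pq: "(p, q) \<in> ET" for p q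
    proof -
      consider "p = l" "q = v0" | "p = v0" "q = l" | "p \<noteq> l" "q \<noteq> l"
        using pq l symD[OF symT pq] by blast
      then show ?thesis
      proof cases
        case 3
        then have "(p, q) \<in> E1" using pq arcsT by (auto simp: E1_def V1_def)
        with 3 edge show ?thesis by (simp add: g_def)
      qed (use y(1) \<phi>(3) lV symD[OF EG(1) y(1)] in \<open>auto simp: g_def\<close>)
    qed
    ultimately show False using free by blast
  qed
  have "\<exists>\<psi>. (\<forall>p\<in>{v0}. \<psi> p = v) \<and> inj_on \<psi> V1 \<and> \<psi> ` V1 \<subseteq> V \<and> \<psi> ` (V1 - {v0}) \<inter> {v} = {} \<and>
     (\<forall>p q. (p, q) \<in> E1 \<longrightarrow> \<not> (p \<in> {v0} \<and> q \<in> {v0}) \<longrightarrow> (\<psi> p, \<psi> q) \<in> E) \<and>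
     connected_in E ({v} \<union> \<psi> ` V1)" (is "\<exists>\<psi>. ?P \<psi>")
  proof (rule greedy_embedding[OF T1 deg1])
    have "E `` {v} \<inter> {v} = {}" using irrefl by (auto simp: irrefl_def)
    then show "card (E `` {v} \<inter> {v}) \<le> card (E1 `` {p} \<inter> {v0})" for p by simp
    show "card {v} + card (V1 - {v0}) \<le> N" using N finV1 v0V1 cardV1 by simp
  qed (use w(1) v0V1 in auto)
  then obtain \<phi>1 where P: "?P \<phi>1" by (rule exE)
  have \<phi>1: "\<phi>1 v0 = v" "inj_on \<phi>1 V1" "\<phi>1 ` V1 \<subseteq> V" using P by simp_all
  have edge1: "(\<phi>1 p, \<phi>1 q) \<in> E" if "(p, q) \<in> E1" for p q
  proof -
    have "p \<noteq> q" using that irrT by (auto simp: E1_def irrefl_def)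
    with that P show ?thesis by auto
  qed
  \<comment> \<open>The first copy occupies \<open>W1\<close>, so the extra neighbour is the image of some \<open>u \<in> W1\<close>.\<close>
  define W1 where "W1 = \<phi>1 ` V1"
  have vW1: "v \<in> W1" using \<phi>1(1) v0V1 unfolding W1_def by blast
  then have W1: "connected_in E W1" using P by (simp add: W1_def insert_absorb)
  have cardW1: "finite W1" "card W1 = card V1" using finV1 \<phi>1(2) by (auto simp: W1_def card_image)
  have "w \<in> f ` W1"
    using no_copy[OF \<phi>1(2,3,1) f(2)[OF edge1] w(2)] unfolding W1_def by blast
  then obtain u where u: "w = f u" "u \<in> W1" by blast
  have uv: "u \<noteq> v" using w(2) u EG(2) by (auto simp: irrefl_def)
  have nuv: "(v, u) \<notin> E" using contra u by auto
  obtain xs where xs: "xs \<noteq> []" "hd xs = v" "last xs = u" "distinct xs" "set xs \<subseteq> W1"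
    "successively (\<lambda>x y. (x, y) \<in> E) xs"
    using connected_in_path[OF W1 vW1 u(2)] by blast
  \<comment> \<open>The second vertex \<open>x\<close> of the path will be the image of \<open>l\<close>. It differs from \<open>u\<close>, as \<open>v\<close> and
    \<open>u\<close> are not adjacent in the regular graph.\<close>
  obtain x ys where xs_eq: "xs = v # x # ys"
    using xs(1-3) uv by (cases xs rule: remdups_adj.cases) auto
  have vx: "(v, x) \<in> E" using xs(6) by (simp add: xs_eq)
  have xu: "x \<noteq> u" "x \<noteq> v" using vx nuv xs(4) by (auto simp: xs_eq)
  have lenxs: "length xs \<le> card V1"
    using xs(4,5) cardW1 card_mono[of W1 "set xs"] by (simp add: distinct_card)
  have lenN: "length xs \<le> N" using lenxs cardV1 N by simp
  have nb_v: "a = b" if "a \<in> E `` {v} \<inter> set xs" "b \<in> E `` {v} \<inter> set xs" for a b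
  proof (rule unique_neighbour[of "set (x # ys)"])
    show "connected_in E (set (x # ys))"
      by (rule connected_in_path_set[OF sym]) (use xs(6) in \<open>simp add: xs_eq\<close>)
    show "card (set (x # ys)) < N" using lenN xs(4) by (simp add: xs_eq distinct_card)
  qed (use that xs(4) irrefl in \<open>auto simp: xs_eq irrefl_def\<close>)
  have snoc: "xs = butlast xs @ [u]" using xs(1,3) append_butlast_last_id by metis
  have nb_u: "a = b" if "a \<in> E `` {u} \<inter> set xs" "b \<in> E `` {u} \<inter> set xs" for a b
  proof (rule unique_neighbour[of "set (butlast xs)"])
    show "connected_in E (set (butlast xs))"
    proof (rule connected_in_path_set[OF sym])
      show "successively (\<lambda>x y. (x, y) \<in> E) (butlast xs)"
        using xs(6) snoc by (metis successively_append_iff)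
    qed
    have "card (set (butlast xs)) \<le> length (butlast xs)" by (rule card_length)
    also have "\<dots> < N" using lenN xs(1) by (cases xs) auto
    finally show "card (set (butlast xs)) < N" .
    show "u \<notin> set (butlast xs)" using xs(4) snoc by (metis distinct_append disjoint_iff list.set_intros(1))
    have "set xs = insert u (set (butlast xs))" using arg_cong[OF snoc, of set] by simp
    then show "a \<in> set (butlast xs)" "b \<in> set (butlast xs)"
      using that irrefl by (auto simp: irrefl_def)
  qed (use that in auto)
  have "E1 `` {v0} \<noteq> {}" using deg_v0 r by auto
  then obtain b where b: "(v0, b) \<in> E1" by blast
  have bV1: "b \<in> V1" "b \<noteq> v0" "(b, v0) \<in> E1"
    using b irrT symD[OF symT] by (auto simp: E1_def irrefl_def)
  \<comment> \<open>The second copy starts with the edge from \<open>v0\<close> to \<open>b\<close> on the extra edge. Treating the whole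
    path as occupied keeps \<open>x\<close> free; each end of the path has just one neighbour on it, which
    matches the single tree edge inside \<open>S\<close>.\<close>
  define S where "S = {v0, b}"
  define \<phi> where "\<phi> = (\<lambda>p. if p = v0 then v else u)"
  have fin1: "finite (E1 `` {q})" for q
    using finite_subset[of "E1 `` {q}" "ET `` {q}"] fin by (auto simp: E1_def)
  have "\<exists>\<psi>. (\<forall>p\<in>S. \<psi> p = \<phi> p) \<and> inj_on \<psi> V1 \<and> \<psi> ` V1 \<subseteq> V \<and> \<psi> ` (V1 - S) \<inter> set xs = {} \<and>
     (\<forall>p q. (p, q) \<in> E1 \<longrightarrow> \<not> (p \<in> S \<and> q \<in> S) \<longrightarrow> (\<psi> p, \<psi> q) \<in> E) \<and>
     connected_in E (set xs \<union> \<psi> ` V1)" (is "\<exists>\<psi>. ?P \<psi>")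
  proof (rule greedy_embedding[OF T1 deg1])
    show "S \<subseteq> V1" "S \<noteq> {}" using bV1 v0V1 by (auto simp: S_def)
    show "connected_in E1 S"
    proof -
      have "sym E1" using T1 by (simp add: tree_on_def)
      then have "connected_in E1 (insert b {v0})"
        by (rule connected_in_insert[where p = v0]) (use b in auto)
      then show ?thesis by (simp add: S_def insert_commute)
    qed
    show "set xs \<subseteq> V" using xs(5) \<phi>1(3) by (auto simp: W1_def)
    show "connected_in E (set xs)" by (rule connected_in_path_set[OF sym xs(6)])
    show "inj_on \<phi> S" using uv by (auto simp: S_def \<phi>_def)
    show "\<phi> ` S \<subseteq> set xs" using snoc by (auto simp: S_def \<phi>_def xs_eq)
    have "card (set xs) \<le> card V1" using lenxs card_length le_trans by blast
    moreover have "card (V1 - S) \<le> card V1" using finV1 by (intro card_mono) auto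
    ultimately show "card (set xs) + card (V1 - S) \<le> N" using N cardV1 by simp
    fix p assume p: "p \<in> S"
    have "card (E `` {\<phi> p} \<inter> set xs) \<le> Suc 0"
      using p nb_v nb_u by (subst card_le_Suc0_iff_eq) (auto simp: S_def \<phi>_def)
    also have "Suc 0 \<le> card (E1 `` {p} \<inter> S)"
      using p b bV1 fin1 by (auto simp: S_def Suc_le_eq card_gt_0_iff)
    finally show "card (E `` {\<phi> p} \<inter> set xs) \<le> card (E1 `` {p} \<inter> S)" .
  qed auto
  then obtain \<phi>2 where P2: "?P \<phi>2" by (rule exE)
  have \<phi>2: "inj_on \<phi>2 V1" "\<phi>2 ` V1 \<subseteq> V" "\<phi>2 ` (V1 - S) \<inter> set xs = {}" using P2 by simp_all
  have \<phi>2S: "\<phi>2 v0 = v" "\<phi>2 b = u" using P2 bV1(2) by (simp_all add: S_def \<phi>_def)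
  have edge2: "(f (\<phi>2 p), f (\<phi>2 q)) \<in> EG" if pq: "(p, q) \<in> E1" for p q
  proof (cases "p \<in> S \<and> q \<in> S")
    case True
    have "p \<noteq> q" using pq irrT by (auto simp: E1_def irrefl_def)
    with True show ?thesis using \<phi>2S w(2) u(1) symD[OF EG(1) w(2)] by (auto simp: S_def)
  next
    case False
    then show ?thesis using P2 pq f(2) by simp
  qed
  have "x \<notin> \<phi>2 ` V1"
  proof
    assume "x \<in> \<phi>2 ` V1"
    then obtain p where p: "p \<in> V1" "x = \<phi>2 p" by blast
    show False
    proof (cases "p \<in> S")
      case True
      then show False using p \<phi>2S xu by (auto simp: S_def)
    next
      case False
      then have "x \<in> \<phi>2 ` (V1 - S) \<inter> set xs" using p by (auto simp: xs_eq)
      then show False using \<phi>2(3) by blast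
    qed
  qed
  moreover have "x \<in> V" using vx arcs by auto
  ultimately have "f x \<notin> f ` \<phi>2 ` V1"
    using inj_on_image_mem_iff[OF f(1) _ \<phi>2(2)] by simp
  with no_copy[OF \<phi>2(1,2) \<phi>2S(1) edge2 f(2)[OF vx]] show False by simp
qed

end

section \<open>Regular graphs with prescribed cycle lengths\<close>

text \<open>
  To make a graph of maximum degree at most \<open>r\<close> regular, infinite trees are hung onto its vertices.
  The vertex \<open>(a, w)\<close> of the completion lies in the tree at \<open>a\<close>, at the node with address \<open>w\<close>
  (read from the node up to the root), and \<open>(a, [])\<close> is \<open>a\<close> itself. The root of a tree has as
  many children as \<open>a\<close> lacks neighbours, every other node has \<open>r - 1\<close>.
\<close>

fun hanging_word :: "nat \<Rightarrow> ('a \<times> 'a) set \<Rightarrow> 'a \<Rightarrow> nat list \<Rightarrow> bool" where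
  "hanging_word r E a [] = True"
| "hanging_word r E a (i # w) =
     (i < (if w = [] then r - card (E `` {a}) else r - 1) \<and> hanging_word r E a w)"

definition completion_verts :: "nat \<Rightarrow> ('a \<times> 'a) set \<Rightarrow> ('a \<times> nat list) set" where
  "completion_verts r E = {(a, w). hanging_word r E a w}"

definition completion_arcs :: "nat \<Rightarrow> ('a \<times> 'a) set \<Rightarrow> (('a \<times> nat list) \<times> ('a \<times> nat list)) set" where
  "completion_arcs r E = {((a, w), (b, v)). w = [] \<and> v = [] \<and> (a, b) \<in> E \<or>
     a = b \<and> ((\<exists>i. v = i # w) \<and> hanging_word r E a v \<or> (\<exists>i. w = i # v) \<and> hanging_word r E a w)}"

lemma completion_arcs_subset: "completion_arcs r E \<subseteq> completion_verts r E \<times> completion_verts r E"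
  by (auto simp: completion_arcs_def completion_verts_def)

lemma sym_completion_arcs: "sym E \<Longrightarrow> sym (completion_arcs r E)"
  unfolding completion_arcs_def by (rule symI) (auto dest: symD)

lemma irrefl_completion_arcs: "irrefl E \<Longrightarrow> irrefl (completion_arcs r E)"
  by (auto simp: completion_arcs_def irrefl_def)

lemma completion_nbrs_root:
  "completion_arcs r E `` {(a, [])} =
     (\<lambda>b. (b, [])) ` (E `` {a}) \<union> (\<lambda>i. (a, [i])) ` {..<r - card (E `` {a})}"
  by (auto simp: completion_arcs_def)

lemma completion_nbrs_word:
  assumes "hanging_word r E a (i # w)"
  shows "completion_arcs r E `` {(a, i # w)} = insert (a, w) ((\<lambda>j. (a, j # i # w)) ` {..<r - 1})"
  using assms by (auto simp: completion_arcs_def split: if_splits)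

lemma completion_regular:
  assumes E: "finite (E `` {fst x})" "card (E `` {fst x}) \<le> r" and r: "0 < r"
    and x: "x \<in> completion_verts r E"
  shows "finite (completion_arcs r E `` {x})" "card (completion_arcs r E `` {x}) = r"
proof -
  obtain a w where aw: "x = (a, w)" by (cases x)
  have "finite (completion_arcs r E `` {x}) \<and> card (completion_arcs r E `` {x}) = r"
  proof (cases w)
    case Nil
    have "card (completion_arcs r E `` {x}) = card ((\<lambda>b. (b, [] :: nat list)) ` (E `` {a}))
        + card ((\<lambda>i. (a, [i])) ` {..<r - card (E `` {a})})"
      unfolding aw Nil completion_nbrs_root using E aw by (intro card_Un_disjoint) auto
    also have "\<dots> = card (E `` {a}) + (r - card (E `` {a}))"
      by (simp add: card_image inj_on_def)
    also have "\<dots> = r" using E aw by simp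
    finally show ?thesis using E unfolding aw Nil completion_nbrs_root by simp
  next
    case (Cons i v)
    have h: "hanging_word r E a (i # v)" using x by (simp add: aw Cons completion_verts_def)
    have "card (completion_arcs r E `` {x}) = Suc (card ((\<lambda>j. (a, j # i # v)) ` {..<r - 1}))"
      unfolding aw Cons completion_nbrs_word[OF h] by (subst card_insert_disjoint) auto
    also have "\<dots> = r" using r by (simp add: card_image inj_on_def)
    finally show ?thesis unfolding aw Cons completion_nbrs_word[OF h] by simp
  qed
  then show "finite (completion_arcs r E `` {x})" "card (completion_arcs r E `` {x}) = r" by auto
qed

lemma completion_connected:
  assumes E: "\<And>b. (a, b) \<in> E\<^sup>*" and x: "x \<in> completion_verts r E"
  shows "((a, []), x) \<in> (completion_arcs r E)\<^sup>*"
proof -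
  obtain b w where bw: "x = (b, w)" by (cases x)
  have "hanging_word r E b w" using x by (simp add: bw completion_verts_def)
  then have "((b, []), (b, w)) \<in> (completion_arcs r E)\<^sup>*"
  proof (induction w)
    case (Cons i w)
    then have "((b, w), (b, i # w)) \<in> completion_arcs r E" by (auto simp: completion_arcs_def)
    with Cons show ?case by (auto intro: rtrancl_into_rtrancl)
  qed simp
  moreover have "((a, []), (b, [])) \<in> (completion_arcs r E)\<^sup>*"
    using E[of b]
  proof (induction rule: rtrancl_induct)
    case (step y z)
    then have "((y, []), (z, [])) \<in> completion_arcs r E" by (auto simp: completion_arcs_def)
    with step show ?case by (auto intro: rtrancl_into_rtrancl)
  qed simp
  ultimately show ?thesis unfolding bw by (rule rtrancl_trans[rotated])
qed

text \<open>
  A vertex of maximal depth in a cyclic set has two neighbours that are not deeper, whereas a node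
  inside a hanging tree has only its parent. So no cyclic set enters the hanging trees.
\<close>

lemma cyclic_set_completion:
  assumes "cyclic_set (completion_arcs r E) C"
  obtains D where "C = (\<lambda>a. (a, [])) ` D" "cyclic_set E D"
proof -
  let ?K = "completion_arcs r E"
  have finC: "finite C" and C0: "C \<noteq> {}"
    and two: "\<And>x. x \<in> C \<Longrightarrow> \<exists>y\<in>C. \<exists>z\<in>C. y \<noteq> z \<and> (x, y) \<in> ?K \<and> (x, z) \<in> ?K"
    using assms by (auto simp: cyclic_set_def)
  define M where "M = Max ((\<lambda>x. length (snd x)) ` C)"
  have le: "length (snd x) \<le> M" if "x \<in> C" for x
    using that finC by (simp add: M_def)
  have "M \<in> (\<lambda>x. length (snd x)) ` C" unfolding M_def using finC C0 by (intro Max_in) auto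
  then obtain x where x: "x \<in> C" "length (snd x) = M" by auto
  obtain y z where yz: "y \<in> C" "z \<in> C" "y \<noteq> z" "(x, y) \<in> ?K" "(x, z) \<in> ?K"
    using two x(1) by blast
  have parent: "y = (fst x, tl (snd x))" if "y \<in> C" "(x, y) \<in> ?K" "snd x \<noteq> []" for y
    using that le[of y] x(2) by (auto simp: completion_arcs_def)
  have "snd x = []" using parent yz by blast
  then have "M = 0" using x by simp
  then have nil: "snd y = []" if "y \<in> C" for y using le[OF that] by simp
  then have C: "C = (\<lambda>a. (a, [])) ` fst ` C" by (force simp: image_iff)
  have "cyclic_set E (fst ` C)" unfolding cyclic_set_def
  proof (intro conjI ballI)
    fix a assume "a \<in> fst ` C"
    then have "(a, []) \<in> C" using nil by force
    from two[OF this] obtain y z where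
      yz: "y \<in> C" "z \<in> C" "y \<noteq> z" "((a, []), y) \<in> ?K" "((a, []), z) \<in> ?K" by blast
    then have "fst y \<noteq> fst z" "(a, fst y) \<in> E" "(a, fst z) \<in> E"
      using nil[of y] nil[of z] by (auto simp: completion_arcs_def prod_eq_iff)
    with yz show "\<exists>y\<in>fst ` C. \<exists>z\<in>fst ` C. y \<noteq> z \<and> (a, y) \<in> E \<and> (a, z) \<in> E" by blast
  qed (use finC C0 in auto)
  with C that show ?thesis by blast
qed

lemma cyclic_set_completion_iff:
  "cyclic_set (completion_arcs r E) ((\<lambda>a. (a, [])) ` D) \<longleftrightarrow> cyclic_set E D"
proof
  assume "cyclic_set (completion_arcs r E) ((\<lambda>a. (a, [])) ` D)"
  then obtain D' where "(\<lambda>a. (a, [] :: nat list)) ` D = (\<lambda>a. (a, [])) ` D'" "cyclic_set E D'"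
    by (rule cyclic_set_completion)
  moreover have "inj (\<lambda>a :: 'a. (a, [] :: nat list))" by (simp add: inj_on_def)
  ultimately show "cyclic_set E D" using inj_image_eq_iff by metis
next
  assume D: "cyclic_set E D"
  have "\<exists>y\<in>D. \<exists>z\<in>D. (y, []) \<noteq> (z, [] :: nat list) \<and> ((a, []), (y, [])) \<in> completion_arcs r E
      \<and> ((a, []), (z, [])) \<in> completion_arcs r E" if "a \<in> D" for a
    using D that by (auto simp: cyclic_set_def completion_arcs_def)
  then show "cyclic_set (completion_arcs r E) ((\<lambda>a. (a, [])) ` D)"
    using D by (simp add: cyclic_set_def)
qed

text \<open>
  The chord from \<open>n\<^sup>2\<close> to \<open>n\<^sup>2 + n - 1\<close> closes a cycle of length \<open>n\<close> on the ray. The squares keep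
  the segments below different chords disjoint, because \<open>n\<^sup>2 + n - 1 < (n + 1)\<^sup>2\<close>.
\<close>

definition chorded_ray :: "nat set \<Rightarrow> (nat \<times> nat) set" where
  "chorded_ray A = {(i, j). j = Suc i \<or> i = Suc j \<or>
     (\<exists>n\<in>A. (i = n\<^sup>2 \<and> j = n\<^sup>2 + (n - 1)) \<or> (j = n\<^sup>2 \<and> i = n\<^sup>2 + (n - 1)))}"

definition chord_segment :: "nat \<Rightarrow> nat set" where
  "chord_segment n = {n\<^sup>2..<n\<^sup>2 + n}"

lemma card_chord_segment [simp]: "card (chord_segment n) = n"
  by (simp add: chord_segment_def)

lemma chord_segment_disjoint:
  assumes "i \<in> chord_segment m" "i \<in> chord_segment n"
  shows "m = n"
proof -
  have *: "\<not> m < n" if "i < m\<^sup>2 + m" "n\<^sup>2 \<le> i" for m n :: nat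
  proof
    assume "m < n"
    then have "(Suc m)\<^sup>2 \<le> n\<^sup>2" by (intro power_mono) auto
    with that show False by (simp add: power2_eq_square)
  qed
  from *[of m n] *[of n m] assms show ?thesis by (auto simp: chord_segment_def)
qed

lemma sym_chorded_ray: "sym (chorded_ray A)"
  by (rule symI) (auto simp: chorded_ray_def)

context
  fixes A :: "nat set"
  assumes A: "A \<subseteq> {3..}"
begin

lemma at_least_three: "n \<in> A \<Longrightarrow> 3 \<le> n"
  using A by auto

lemma irrefl_chorded_ray: "irrefl (chorded_ray A)"
  using at_least_three by (force simp: chorded_ray_def irrefl_def)

lemma chorded_ray_nbrs:
  shows "\<exists>c. chorded_ray A `` {i} \<subseteq> {Suc i, i - 1, c}"
proof (cases "\<exists>n\<in>A. i = n\<^sup>2 \<or> i = n\<^sup>2 + (n - 1)")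
  case False
  then show ?thesis by (auto simp: chorded_ray_def)
next
  case True
  then obtain n where n: "n \<in> A" "i = n\<^sup>2 \<or> i = n\<^sup>2 + (n - 1)" by blast
  have inseg: "m\<^sup>2 \<in> chord_segment m" "m\<^sup>2 + (m - 1) \<in> chord_segment m" if "m \<in> A" for m
    using at_least_three[OF that] by (auto simp: chord_segment_def)
  have n3: "3 \<le> n" using at_least_three n by blast
  have same: "m = n" if "m \<in> A" "i = m\<^sup>2 \<or> i = m\<^sup>2 + (m - 1)" for m
    using chord_segment_disjoint[of i m n] inseg that n by metis
  have "j \<in> {Suc i, i - 1, if i = n\<^sup>2 then n\<^sup>2 + (n - 1) else n\<^sup>2}"
    if ij: "(i, j) \<in> chorded_ray A" for j
  proof -
    consider "j = Suc i" | "i = Suc j" | m where "m \<in> A" "i = m\<^sup>2" "j = m\<^sup>2 + (m - 1)"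
      | m where "m \<in> A" "j = m\<^sup>2" "i = m\<^sup>2 + (m - 1)"
      using ij unfolding chorded_ray_def by blast
    then show ?thesis
    proof cases
      case 3
      with same[of m] show ?thesis by simp
    next
      case 4
      with same[of m] n3 show ?thesis by simp
    qed simp_all
  qed
  then have "chorded_ray A `` {i} \<subseteq> {Suc i, i - 1, if i = n\<^sup>2 then n\<^sup>2 + (n - 1) else n\<^sup>2}"
    by blast
  then show ?thesis by blast
qed

lemma chorded_ray_degree: "finite (chorded_ray A `` {i})" "card (chorded_ray A `` {i}) \<le> 3"
proof -
  obtain c where c: "chorded_ray A `` {i} \<subseteq> {Suc i, i - 1, c}" using chorded_ray_nbrs by blast
  then show "finite (chorded_ray A `` {i})" by (rule finite_subset) simp
  have "card (chorded_ray A `` {i}) \<le> card {Suc i, i - 1, c}" using c by (intro card_mono) auto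
  also have "\<dots> \<le> 3" by (simp add: card_insert_if)
  finally show "card (chorded_ray A `` {i}) \<le> 3" .
qed

lemma chorded_ray_connected: "(0, i) \<in> (chorded_ray A)\<^sup>*"
proof (induction i)
  case (Suc i)
  have "(i, Suc i) \<in> chorded_ray A" by (simp add: chorded_ray_def)
  with Suc show ?case by (rule rtrancl_into_rtrancl)
qed simp

lemma cyclic_set_chord_segment:
  assumes n: "n \<in> A"
  shows "cyclic_set (chorded_ray A) (chord_segment n)"
  unfolding cyclic_set_def
proof (intro conjI ballI)
  have n3: "3 \<le> n" using at_least_three n by blast
  then show "chord_segment n \<noteq> {}" by (simp add: chord_segment_def)
  show "finite (chord_segment n)" by (simp add: chord_segment_def)
  fix i assume i: "i \<in> chord_segment n"
  then consider "i = n\<^sup>2" | "i = n\<^sup>2 + (n - 1)" | "n\<^sup>2 < i" "Suc i < n\<^sup>2 + n"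
    by (force simp: chord_segment_def)
  then show "\<exists>y\<in>chord_segment n. \<exists>z\<in>chord_segment n.
      y \<noteq> z \<and> (i, y) \<in> chorded_ray A \<and> (i, z) \<in> chorded_ray A"
  proof cases
    case 1
    then show ?thesis using n n3
      by (intro bexI[of _ "Suc i"] bexI[of _ "n\<^sup>2 + (n - 1)"])
        (auto simp: chorded_ray_def chord_segment_def)
  next
    case 2
    then show ?thesis using n n3
      by (intro bexI[of _ "i - 1"] bexI[of _ "n\<^sup>2"])
        (auto simp: chorded_ray_def chord_segment_def)
  next
    case 3
    then show ?thesis
      by (intro bexI[of _ "i - 1"] bexI[of _ "Suc i"])
        (auto simp: chorded_ray_def chord_segment_def)
  qed
qed

text \<open>
  The least element of a cyclic set has two larger neighbours in it, so it is the lower end of a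
  chord. From there the set has to continue along the ray up to the other end, as an inner vertex
  of the segment has no neighbours besides its predecessor and successor.
\<close>

lemma cyclic_set_chorded_ray:
  assumes D: "cyclic_set (chorded_ray A) D"
  shows "\<exists>n\<in>A. chord_segment n \<subseteq> D"
proof -
  have finD: "finite D" and D0: "D \<noteq> {}"
    and two: "\<And>x. x \<in> D \<Longrightarrow> \<exists>y\<in>D. \<exists>z\<in>D. y \<noteq> z \<and> (x, y) \<in> chorded_ray A \<and> (x, z) \<in> chorded_ray A"
    using D by (auto simp: cyclic_set_def)
  define m where "m = Min D"
  have mD: "m \<in> D" and min: "\<And>x. x \<in> D \<Longrightarrow> m \<le> x"
    using finD D0 by (auto simp: m_def)
  obtain y z where yz: "y \<in> D" "z \<in> D" "y \<noteq> z" "(m, y) \<in> chorded_ray A" "(m, z) \<in> chorded_ray A"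
    using two[OF mD] by blast
  have up: "y = Suc m \<or> (\<exists>n\<in>A. m = n\<^sup>2 \<and> y = n\<^sup>2 + (n - 1))"
    if "y \<in> D" "(m, y) \<in> chorded_ray A" for y
    using that min[of y] at_least_three by (force simp: chorded_ray_def)
  have same: "n = k" if "n\<^sup>2 = k\<^sup>2" for n k :: nat using that by simp
  have "\<exists>n\<in>A. m = n\<^sup>2 \<and> Suc m \<in> D"
    using up[OF yz(1,4)] up[OF yz(2,5)] yz(1-3) same by metis
  then obtain n where n: "n \<in> A" "m = n\<^sup>2" "Suc m \<in> D" by blast
  have n3: "3 \<le> n" using at_least_three n by blast
  have "n\<^sup>2 + k \<in> D" if "k < n" for k
    using that
  proof (induction k)
    case 0
    then show ?case using mD n by simp
  next
    case (Suc k)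
    show ?case
    proof (cases "k = 0")
      case True
      then show ?thesis using n by simp
    next
      case False
      let ?i = "n\<^sup>2 + k"
      have iD: "?i \<in> D" using Suc by simp
      have iseg: "?i \<in> chord_segment n" using Suc by (simp add: chord_segment_def)
      have nb: "j = Suc ?i \<or> ?i = Suc j" if "(?i, j) \<in> chorded_ray A" for j
      proof (rule ccontr)
        assume "\<not> ?thesis"
        with that obtain l where l: "l \<in> A" "?i = l\<^sup>2 \<or> ?i = l\<^sup>2 + (l - 1)"
          unfolding chorded_ray_def by blast
        then have "?i \<in> chord_segment l" using at_least_three[OF l(1)] by (auto simp: chord_segment_def)
        then have "l = n" using chord_segment_disjoint iseg by blast
        with l(2) False Suc.prems show False by auto
      qed
      obtain y z where "y \<in> D" "z \<in> D" "y \<noteq> z" "(?i, y) \<in> chorded_ray A" "(?i, z) \<in> chorded_ray A"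
        using two[OF iD] by blast
      then have "Suc ?i \<in> D" using nb[of y] nb[of z] by auto
      then show ?thesis by simp
    qed
  qed
  then have "chord_segment n \<subseteq> D"
    unfolding chord_segment_def by (auto simp: le_iff_add)
  with n(1) show ?thesis by blast
qed

end

text \<open>
  Minimal cyclic sets are the vertex sets of induced cycles. Minimality excludes unions of several
  cycles, so that the sizes can be prescribed independently of each other.
\<close>

definition circuit :: "('a \<times> 'a) set \<Rightarrow> 'a set \<Rightarrow> bool" where
  "circuit E C \<longleftrightarrow> cyclic_set E C \<and> (\<forall>C'\<subseteq>C. cyclic_set E C' \<longrightarrow> C' = C)"

definition circuit_sizes :: "'a set \<Rightarrow> ('a \<times> 'a) set \<Rightarrow> nat set" where
  "circuit_sizes V E = card ` {C. C \<subseteq> V \<and> circuit E C}"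

lemma cyclic_set_completion_chorded_ray:
  assumes A: "A \<subseteq> {3..}" and C: "cyclic_set (completion_arcs r (chorded_ray A)) C"
  shows "\<exists>n\<in>A. (\<lambda>i. (i, [])) ` chord_segment n \<subseteq> C"
proof -
  obtain D where D: "C = (\<lambda>a. (a, [])) ` D" "cyclic_set (chorded_ray A) D"
    using C by (rule cyclic_set_completion)
  then obtain n where "n \<in> A" "chord_segment n \<subseteq> D" using cyclic_set_chorded_ray A by blast
  with D(1) show ?thesis by blast
qed

lemma circuit_sizes_completion_chorded_ray:
  assumes A: "A \<subseteq> {3..}"
  shows "circuit_sizes (completion_verts r (chorded_ray A)) (completion_arcs r (chorded_ray A)) = A"
    (is "circuit_sizes ?V ?E = A")
proof -
  let ?seg = "\<lambda>n. (\<lambda>i. (i, [] :: nat list)) ` chord_segment n"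
  have card_seg: "card (?seg n) = n" for n
    by (simp add: card_image inj_on_def)
  have cyc_seg: "cyclic_set ?E (?seg n)" if "n \<in> A" for n
    using cyclic_set_chord_segment[OF A that] by (simp add: cyclic_set_completion_iff)
  have "n \<in> circuit_sizes ?V ?E" if n: "n \<in> A" for n
  proof -
    have "C = ?seg n" if C: "C \<subseteq> ?seg n" "cyclic_set ?E C" for C
    proof -
      obtain m where m: "m \<in> A" "?seg m \<subseteq> C"
        using cyclic_set_completion_chorded_ray[OF A C(2)] by blast
      have "m\<^sup>2 \<in> chord_segment m" using A m(1) by (auto simp: chord_segment_def)
      moreover from this have "m\<^sup>2 \<in> chord_segment n" using m(2) C(1) by auto
      ultimately have "m = n" by (rule chord_segment_disjoint)
      with m C show ?thesis by blast
    qed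
    then have "circuit ?E (?seg n)" using cyc_seg[OF n] by (auto simp: circuit_def)
    moreover have "?seg n \<subseteq> ?V" by (auto simp: completion_verts_def)
    ultimately show ?thesis unfolding circuit_sizes_def
      using card_seg[of n] by (intro image_eqI[of _ _ "?seg n"]) auto
  qed
  moreover have "n \<in> A" if n: "n \<in> circuit_sizes ?V ?E" for n
  proof -
    obtain C where C: "circuit ?E C" "n = card C" using n unfolding circuit_sizes_def by blast
    then have "cyclic_set ?E C" by (simp add: circuit_def)
    then obtain m where m: "m \<in> A" "?seg m \<subseteq> C"
      using cyclic_set_completion_chorded_ray[OF A] by metis
    then have "?seg m = C" using C(1) cyc_seg by (auto simp: circuit_def)
    then show ?thesis using C(2) card_seg m(1) by metis
  qed
  ultimately show ?thesis by blast
qed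

lemma regular_graph_completion_chorded_ray:
  assumes A: "A \<subseteq> {3..}" "A \<subseteq> {N<..}" and r: "3 \<le> r"
  shows "regular_graph_of_large_girth (completion_verts r (chorded_ray A))
    (completion_arcs r (chorded_ray A)) r N"
proof
  let ?E = "completion_arcs r (chorded_ray A)"
  have deg: "finite (chorded_ray A `` {i})" "card (chorded_ray A `` {i}) \<le> r" for i
    using chorded_ray_degree[OF A(1), of i] r by auto
  show "sym ?E" by (rule sym_completion_arcs[OF sym_chorded_ray])
  show "irrefl ?E" by (rule irrefl_completion_arcs[OF irrefl_chorded_ray[OF A(1)]])
  show "finite (?E `` {x})" "card (?E `` {x}) = r" if "x \<in> completion_verts r (chorded_ray A)" for x
    using completion_regular[OF deg _ that] r by auto
  show "N < card C" if C: "cyclic_set ?E C" for C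
  proof -
    obtain n where n: "n \<in> A" "(\<lambda>i. (i, [])) ` chord_segment n \<subseteq> C"
      using cyclic_set_completion_chorded_ray[OF A(1) C] by blast
    have "N < n" using A(2) n(1) by auto
    also have "n = card ((\<lambda>i. (i, [] :: nat list)) ` chord_segment n)"
      by (simp add: card_image inj_on_def)
    also have "\<dots> \<le> card C" using n(2) C by (intro card_mono) (auto simp: cyclic_set_def)
    finally show ?thesis .
  qed
qed (rule completion_arcs_subset)

lemma circuit_sizes_image:
  assumes f: "inj_on f V" and E: "\<And>u v. u \<in> V \<Longrightarrow> v \<in> V \<Longrightarrow> (f u, f v) \<in> E' \<longleftrightarrow> (u, v) \<in> E"
  shows "circuit_sizes (f ` V) E' = circuit_sizes V E"
proof -
  have cyc: "cyclic_set E' (f ` C) \<longleftrightarrow> cyclic_set E C" if C: "C \<subseteq> V" for C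
  proof -
    have injC: "inj_on f C" using inj_on_subset[OF f C] .
    have "(\<exists>y\<in>f ` C. \<exists>z\<in>f ` C. y \<noteq> z \<and> (f x, y) \<in> E' \<and> (f x, z) \<in> E') \<longleftrightarrow>
        (\<exists>y\<in>C. \<exists>z\<in>C. y \<noteq> z \<and> (x, y) \<in> E \<and> (x, z) \<in> E)" if "x \<in> C" for x
    proof -
      have "f y \<noteq> f z \<and> (f x, f y) \<in> E' \<and> (f x, f z) \<in> E' \<longleftrightarrow>
          y \<noteq> z \<and> (x, y) \<in> E \<and> (x, z) \<in> E" if "y \<in> C" "z \<in> C" for y z
        using E[of x y] E[of x z] inj_on_eq_iff[OF injC] that \<open>x \<in> C\<close> C by auto
      then show ?thesis by (simp cong: bex_cong)
    qed
    then show ?thesis using finite_image_iff[OF injC] by (simp add: cyclic_set_def)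
  qed
  have circ: "circuit E' (f ` C) \<longleftrightarrow> circuit E C" if C: "C \<subseteq> V" for C
  proof -
    have "(\<forall>D\<subseteq>f ` C. cyclic_set E' D \<longrightarrow> D = f ` C) \<longleftrightarrow>
        (\<forall>D\<subseteq>C. cyclic_set E' (f ` D) \<longrightarrow> f ` D = f ` C)"
      by (rule all_subset_image)
    also have "\<dots> \<longleftrightarrow> (\<forall>D\<subseteq>C. cyclic_set E D \<longrightarrow> D = C)"
      using cyc C inj_on_image_eq_iff[OF f _ C] by (meson subset_trans)
    finally show ?thesis using cyc[OF C] by (simp add: circuit_def)
  qed
  have "{D. D \<subseteq> f ` V \<and> circuit E' D} = (\<lambda>C. f ` C) ` {C. C \<subseteq> V \<and> circuit E C}"
    using circ by (auto simp: subset_image_iff)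
  then have "circuit_sizes (f ` V) E' = (\<lambda>C. card (f ` C)) ` {C. C \<subseteq> V \<and> circuit E C}"
    by (simp only: circuit_sizes_def image_image)
  also have "\<dots> = card ` {C. C \<subseteq> V \<and> circuit E C}"
    using card_image[OF inj_on_subset[OF f]] by (intro image_cong) auto
  finally show ?thesis by (simp only: circuit_sizes_def)
qed

section \<open>Trees with a leaf at the centre\<close>

lemma countable_graph_iff:
  "countable_graph G \<longleftrightarrow> countable (pverts G) \<and> parcs G \<subseteq> pverts G \<times> pverts G \<and>
     sym (parcs G) \<and> irrefl (parcs G)" (is "?L \<longleftrightarrow> ?R")
proof
  assume ?L
  then interpret pair_bidirected_digraph G by (simp add: countable_graph_def)
  have "irrefl (parcs G)" by (rule irreflI) (use pair_no_loops in force)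
  with \<open>?L\<close> show ?R
    using pair_sym_arcs by (auto simp: countable_graph_def symmetric_def dest: wellformed')
next
  assume R: ?R
  then have "pair_bidirected_digraph G"
    by unfold_locales (auto simp: symmetric_def irrefl_def)
  with R show ?L by (simp add: countable_graph_def)
qed

lemma countable_graph_wf: "countable_graph G \<Longrightarrow> pair_wf_digraph G"
  by (simp add: countable_graph_def pair_bidirected_digraph_def pair_sym_digraph_def)

lemma pair_wf_digraphI: "parcs G \<subseteq> pverts G \<times> pverts G \<Longrightarrow> pair_wf_digraph G"
  by unfold_locales auto

text \<open>
  Cantor's argument: a copy of an \<open>r\<close>-regular connected graph without short cycles fills a component
  of \<open>G\<close>, whose circuit sizes are then those of the graph. As \<open>G\<close> has only countably many
  vertices, the set of circuit sizes can be chosen to differ from that of every component.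
\<close>

lemma not_universal_of_leaf_at_centre:
  fixes T :: "'a pair_pre_digraph" and G :: "'b pair_pre_digraph"
  assumes T: "tree_on (pverts T) (parcs T)" and v0: "card (parcs T `` {v0}) = Suc r"
    and others: "\<And>p. p \<in> pverts T \<Longrightarrow> p \<noteq> v0 \<Longrightarrow> card (parcs T `` {p}) \<le> r"
    and l: "(v0, l) \<in> parcs T" "parcs T `` {l} = {v0}"
    and r: "3 \<le> r"
  shows "\<not> weakly_universal T G"
proof
  assume wu: "weakly_universal T G"
  let ?VT = "pverts T" and ?ET = "parcs T" and ?V = "pverts G" and ?E = "parcs G"
  have finT: "finite ?VT" and arcsT: "?ET \<subseteq> ?VT \<times> ?VT" and connT: "connected_in ?ET ?VT"
    using T by (auto simp: tree_on_def)
  have wfT: "pair_wf_digraph T" by (rule pair_wf_digraphI[OF arcsT])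
  have cG: "countable_graph G" and freeG: "free_of T G" using wu by (auto simp: weakly_universal_def)
  have wfG: "pair_wf_digraph G" using cG by (rule countable_graph_wf)
  have G: "countable ?V" "?E \<subseteq> ?V \<times> ?V" "sym ?E" "irrefl ?E" using cG by (auto simp: countable_graph_iff)
  have v0V: "v0 \<in> ?VT" using l arcsT by auto
  have nbr: "\<exists>q. (p, q) \<in> ?ET" if "p \<in> ?VT" for p
  proof (cases "p = v0")
    case False
    have "(p, v0) \<in> (Restr ?ET ?VT)\<^sup>*" using connT that v0V by (auto simp: connected_in_def)
    then show ?thesis using False by (auto elim: converse_rtranclE)
  qed (use l in blast)
  have free: "\<nexists>g. inj_on g ?VT \<and> (\<forall>p q. (p, q) \<in> ?ET \<longrightarrow> (g p, g q) \<in> ?E)"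
  proof
    assume "\<exists>g. inj_on g ?VT \<and> (\<forall>p q. (p, q) \<in> ?ET \<longrightarrow> (g p, g q) \<in> ?E)"
    then obtain g where g: "inj_on g ?VT" "\<forall>p q. (p, q) \<in> ?ET \<longrightarrow> (g p, g q) \<in> ?E" by blast
    have "g ` ?VT \<subseteq> ?V" using g(2) nbr G(2) by blast
    then have "has_subgraph_iso G T" using g by (auto simp: has_subgraph_iso_iff[OF wfT wfG])
    with freeG show False by (simp add: free_of_def)
  qed
  define N where "N = 2 * card ?VT"
  define K where "K = N + 3"
  define comp where "comp x = ?E\<^sup>* `` {x}" for x
  \<comment> \<open>The number \<open>K + k\<close> separates \<open>A\<close> from the component of the \<open>k\<close>-th vertex. Starting at \<open>K\<close> keeps
    all cycles longer than \<open>N\<close>, and at least 3.\<close>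
  define A where "A = {n. K \<le> n \<and> n \<notin> circuit_sizes (comp (from_nat_into ?V (n - K))) ?E}"
  have A: "A \<subseteq> {3..}" "A \<subseteq> {N<..}" by (auto simp: A_def K_def)
  define VH where "VH = completion_verts r (chorded_ray A)"
  define EH where "EH = completion_arcs r (chorded_ray A)"
  define H where "H = \<lparr>pverts = VH, parcs = EH\<rparr>"
  interpret H: regular_graph_of_large_girth VH EH r N
    unfolding VH_def EH_def by (rule regular_graph_completion_chorded_ray[OF A r])
  have cH: "countable_graph H"
    using H.arcs H.sym H.irrefl by (simp add: countable_graph_iff H_def)
  have wfH: "pair_wf_digraph H" using cH by (rule countable_graph_wf)
  have "free_of T H" unfolding free_of_def
  proof
    assume "has_subgraph_iso H T"
    then obtain g where g: "inj_on g ?VT" "g ` ?VT \<subseteq> VH"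
      "\<And>p q. (p, q) \<in> ?ET \<Longrightarrow> (g p, g q) \<in> EH"
      unfolding has_subgraph_iso_iff[OF wfT wfH] by (auto simp: H_def)
    have gv: "g v0 \<in> VH" using g(2) v0V by blast
    have "?ET `` {v0} \<subseteq> ?VT" using arcsT by blast
    then have "Suc r = card (g ` (?ET `` {v0}))"
      using v0 card_image[OF inj_on_subset[OF g(1)]] by simp
    also have "\<dots> \<le> card (EH `` {g v0})"
      using g(3) H.finite_nbrs[OF gv] by (intro card_mono) auto
    also have "\<dots> = r" using H.regular[OF gv] .
    finally show False by simp
  qed
  then have "has_subgraph_iso G H" by (rule weakly_universal_all_types[OF wu wfT cH])
  then obtain f where f: "inj_on f VH" "f ` VH \<subseteq> ?V"
      "\<And>x y. (x, y) \<in> EH \<Longrightarrow> (f x, f y) \<in> ?E"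
    unfolding has_subgraph_iso_iff[OF wfH wfG] by (auto simp: H_def)
  have local: "w \<in> f ` (EH `` {v})" if "v \<in> VH" "(f v, w) \<in> ?E" for v w
    by (rule H.no_extra_neighbour[OF T v0 others l _ _ G(3,4) f(1,3) free that])
      (use r in \<open>auto simp: N_def\<close>)
  define root where "root = (0 :: nat, [] :: nat list)"
  have root: "root \<in> VH" by (simp add: root_def VH_def completion_verts_def)
  have "comp (f root) = f ` VH"
  proof
    have "x \<in> f ` VH" if "(f root, x) \<in> ?E\<^sup>*" for x
      using that
    proof (induction rule: rtrancl_induct)
      case (step y z)
      then obtain v where "v \<in> VH" "y = f v" by blast
      with local[of v z] step.hyps H.arcs show ?case by blast
    qed (use root in blast)
    then show "comp (f root) \<subseteq> f ` VH" by (auto simp: comp_def)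
    have "(f root, f x) \<in> ?E\<^sup>*" if "x \<in> VH" for x
    proof -
      have "(root, x) \<in> EH\<^sup>*" unfolding root_def EH_def
        by (rule completion_connected[OF chorded_ray_connected[OF A(1)]])
          (use that in \<open>simp add: VH_def\<close>)
      then show ?thesis
        by (induction rule: rtrancl_induct) (auto intro: rtrancl_into_rtrancl f(3))
    qed
    then show "f ` VH \<subseteq> comp (f root)" by (auto simp: comp_def)
  qed
  moreover have "(f u, f v) \<in> ?E \<longleftrightarrow> (u, v) \<in> EH" if uv: "u \<in> VH" "v \<in> VH" for u v
  proof
    assume "(f u, f v) \<in> ?E"
    then obtain v' where v': "(u, v') \<in> EH" "f v = f v'" using local uv(1) by blast
    then have "v = v'" using inj_onD[OF f(1)] uv(2) H.arcs by blast
    with v' show "(u, v) \<in> EH" by simp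
  qed (rule f(3))
  ultimately have "circuit_sizes (comp (f root)) ?E = circuit_sizes VH EH"
    using circuit_sizes_image[OF f(1)] by metis
  also have "\<dots> = A"
    unfolding VH_def EH_def by (rule circuit_sizes_completion_chorded_ray[OF A(1)])
  finally have sizes: "circuit_sizes (comp (f root)) ?E = A" .
  obtain k where k: "from_nat_into ?V k = f root"
    using from_nat_into_surj[OF G(1)] f(2) root by blast
  have "K + k \<in> A \<longleftrightarrow> K + k \<notin> circuit_sizes (comp (f root)) ?E" by (simp add: A_def k)
  with sizes show False by blast
qed

section \<open>Pruning the leaves\<close>

text \<open>
  An isolated vertex also counts as a leaf.
\<close>

definition leaves :: "'a pair_pre_digraph \<Rightarrow> 'a set" where
  "leaves T = {x \<in> pverts T. \<exists>p. parcs T `` {x} \<subseteq> {p}}"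

definition prune :: "'a pair_pre_digraph \<Rightarrow> 'a pair_pre_digraph" where
  "prune T = \<lparr>pverts = pverts T - leaves T, parcs = Restr (parcs T) (pverts T - leaves T)\<rparr>"

text \<open>
  Leaves can be added one after the other at vertices of infinite degree, as only finitely many
  neighbours are occupied.
\<close>

lemma extend_to_leaves:
  assumes L: "finite L" and V: "finite V" "V \<inter> L = {}" and g: "inj_on g V"
    and par: "\<And>x. x \<in> L \<Longrightarrow> infinite (E `` {g (par x)})"
  shows "\<exists>g'. inj_on g' (V \<union> L) \<and> (\<forall>x\<in>V. g' x = g x) \<and> (\<forall>x\<in>L. (g (par x), g' x) \<in> E)"
  using L V(2) par
proof (induction L)
  case empty
  then show ?case using g by (intro exI[of _ g]) auto
next
  case (insert x L)
  then obtain g' where g': "inj_on g' (V \<union> L)" "\<forall>x\<in>V. g' x = g x" "\<forall>x\<in>L. (g (par x), g' x) \<in> E"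
    by auto
  have "finite (g' ` (V \<union> L))" using V(1) insert.hyps by simp
  moreover have "infinite (E `` {g (par x)})" using insert.prems by simp
  ultimately have "\<not> E `` {g (par x)} \<subseteq> g' ` (V \<union> L)" using finite_subset by blast
  then obtain y where y: "(g (par x), y) \<in> E" "y \<notin> g' ` (V \<union> L)" by blast
  have x: "x \<notin> V \<union> L" using insert by auto
  have "(g'(x := y)) x \<notin> (g'(x := y)) ` (V \<union> L - {x})" using y(2) x by auto
  then have "inj_on (g'(x := y)) (insert x (V \<union> L))"
    using inj_on_fun_updI[OF g'(1) y(2), of x] by (simp only: inj_on_insert simp_thms)
  then have "inj_on (g'(x := y)) (V \<union> insert x L)" by simp
  moreover have "\<forall>z\<in>V. (g'(x := y)) z = g z" "\<forall>z\<in>insert x L. (g (par z), (g'(x := y)) z) \<in> E"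
    using g' y x by auto
  ultimately show ?case by blast
qed

text \<open>
  The vertices of infinite degree induce a weakly universal graph for the pruned tree. They contain
  no copy of it, because the leaves could be added to such a copy. Conversely, let \<open>H\<close> omit the
  pruned tree and hang infinitely many new vertices onto each vertex of \<open>H\<close>. In a copy of \<open>T\<close> in the
  resulting graph, the vertices that are not leaves have two neighbours and hence lie in \<open>H\<close>, so
  there is no such copy; thus the enlarged graph embeds in \<open>G\<close>, and \<open>H\<close> goes to vertices of
  infinite degree.
\<close>

lemma weakly_universal_prune:
  fixes T :: "'a pair_pre_digraph" and G :: "'b pair_pre_digraph"
  assumes fin: "finite (pverts T)" and arcsT: "parcs T \<subseteq> pverts T \<times> pverts T" and symT: "sym (parcs T)"
    and par: "\<And>x. x \<in> leaves T \<Longrightarrow> \<exists>p\<in>pverts T - leaves T. (x, p) \<in> parcs T"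
    and wu: "weakly_universal T G"
  shows "\<exists>G' :: 'b pair_pre_digraph. weakly_universal (prune T) G'"
proof -
  let ?L = "leaves T" and ?V = "pverts G" and ?E = "parcs G"
  let ?VT' = "pverts T - leaves T"
  have cG: "countable_graph G" and freeG: "free_of T G" using wu by (auto simp: weakly_universal_def)
  have wfG: "pair_wf_digraph G" using cG by (rule countable_graph_wf)
  have G: "countable ?V" "?E \<subseteq> ?V \<times> ?V" "sym ?E" "irrefl ?E" using cG by (auto simp: countable_graph_iff)
  have wfT: "pair_wf_digraph T" by (rule pair_wf_digraphI[OF arcsT])
  have wfT': "pair_wf_digraph (prune T)" by (rule pair_wf_digraphI) (auto simp: prune_def)
  define V' where "V' = {v \<in> ?V. infinite (?E `` {v})}"
  define G' where "G' = \<lparr>pverts = V', parcs = Restr ?E V'\<rparr>"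
  have "countable V'" using G(1) by (simp add: V'_def)
  then have cG': "countable_graph G'"
    using G(3,4) by (auto simp: countable_graph_iff G'_def irrefl_def sym_def)
  have wfG': "pair_wf_digraph G'" using cG' by (rule countable_graph_wf)
  have "free_of (prune T) G'" unfolding free_of_def
  proof
    assume "has_subgraph_iso G' (prune T)"
    then obtain g where g: "inj_on g ?VT'" "g ` ?VT' \<subseteq> V'"
      "\<And>p q. (p, q) \<in> Restr (parcs T) ?VT' \<Longrightarrow> (g p, g q) \<in> Restr ?E V'"
      unfolding has_subgraph_iso_iff[OF wfT' wfG'] by (auto simp: prune_def G'_def)
    have "\<forall>x\<in>?L. \<exists>p. p \<in> ?VT' \<and> (x, p) \<in> parcs T" using par by blast
    then obtain \<pi> where \<pi>: "\<And>x. x \<in> ?L \<Longrightarrow> \<pi> x \<in> ?VT' \<and> (x, \<pi> x) \<in> parcs T" by metis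
    have LV: "?L \<subseteq> pverts T" by (auto simp: leaves_def)
    have "infinite (?E `` {g (\<pi> x)})" if "x \<in> ?L" for x
      using \<pi>[OF that] g(2) by (auto simp: V'_def)
    then obtain g' where g': "inj_on g' (?VT' \<union> ?L)" "\<forall>x\<in>?VT'. g' x = g x"
        "\<forall>x\<in>?L. (g (\<pi> x), g' x) \<in> ?E"
      using extend_to_leaves[of ?L ?VT' g ?E \<pi>] fin LV g(1) finite_subset[OF LV fin] by blast
    have only: "q = \<pi> p" if "(p, q) \<in> parcs T" "p \<in> ?L" for p q
      using that \<pi>[OF that(2)] by (auto simp: leaves_def)
    have edge: "(g' p, g' q) \<in> ?E" if pq: "(p, q) \<in> parcs T" for p q
    proof -
      have qp: "(q, p) \<in> parcs T" using symD[OF symT pq] .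
      consider "p \<in> ?L" | "q \<in> ?L" | "p \<in> ?VT'" "q \<in> ?VT'" using pq arcsT by blast
      then show ?thesis
      proof cases
        case 1
        then have "q = \<pi> p" "(g (\<pi> p), g' p) \<in> ?E" "\<pi> p \<in> ?VT'" using only pq g'(3) \<pi> by blast+
        then show ?thesis using g'(2) symD[OF G(3)] by metis
      next
        case 2
        then have "p = \<pi> q" "(g (\<pi> q), g' q) \<in> ?E" "\<pi> q \<in> ?VT'" using only qp g'(3) \<pi> by blast+
        then show ?thesis using g'(2) by metis
      next
        case 3
        then show ?thesis using g(3)[of p q] g'(2) pq by auto
      qed
    qed
    have VT: "?VT' \<union> ?L = pverts T" using LV by blast
    have "g' p \<in> ?V" if "p \<in> pverts T" for p
    proof (cases "p \<in> ?L")
      case True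
      then show ?thesis using g'(3) G(2) by blast
    next
      case False
      then show ?thesis using g'(2) g(2) that by (auto simp: V'_def)
    qed
    then have "has_subgraph_iso G T"
      using g'(1) edge unfolding has_subgraph_iso_iff[OF wfT wfG] VT by blast
    with freeG show False by (simp add: free_of_def)
  qed
  moreover have "has_subgraph_iso G' H" if H: "countable_graph H" "free_of (prune T) H"
    for H :: "nat pair_pre_digraph"
  proof -
    let ?VH = "pverts H" and ?EH = "parcs H"
    have wfH: "pair_wf_digraph H" using H(1) by (rule countable_graph_wf)
    have H': "?EH \<subseteq> ?VH \<times> ?VH" "sym ?EH" "irrefl ?EH" using H(1) by (auto simp: countable_graph_iff)
    \<comment> \<open>The vertex \<open>(u, 0)\<close> stands for \<open>u\<close> itself, and \<open>(u, Suc i)\<close> for the new vertices at \<open>u\<close>.\<close>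
    define VP where "VP = ?VH \<times> (UNIV :: nat set)"
    define EP :: "((nat \<times> nat) \<times> nat \<times> nat) set" where "EP = {((u, i), (v, j)). i = 0 \<and> j = 0 \<and> (u, v) \<in> ?EH \<or>
        u = v \<and> u \<in> ?VH \<and> (i = 0 \<longleftrightarrow> j \<noteq> (0 :: nat))}"
    define P where "P = \<lparr>pverts = VP, parcs = EP\<rparr>"
    have "EP \<subseteq> VP \<times> VP" using H'(1) by (auto simp: EP_def VP_def)
    moreover have "sym EP" by (rule symI) (auto simp: EP_def dest: symD[OF H'(2)])
    moreover have "irrefl EP" using H'(3) by (auto simp: EP_def irrefl_def)
    ultimately have cP: "countable_graph P" by (simp add: countable_graph_iff P_def)
    have wfP: "pair_wf_digraph P" using cP by (rule countable_graph_wf)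
    have "free_of T P" unfolding free_of_def
    proof
      assume "has_subgraph_iso P T"
      then obtain g where g: "inj_on g (pverts T)" "g ` pverts T \<subseteq> VP"
        "\<And>p q. (p, q) \<in> parcs T \<Longrightarrow> (g p, g q) \<in> EP"
        unfolding has_subgraph_iso_iff[OF wfT wfP] by (auto simp: P_def)
      have zero: "snd (g p) = 0" if p: "p \<in> ?VT'" for p
      proof (rule ccontr)
        assume nz: "snd (g p) \<noteq> 0"
        have "\<not> parcs T `` {p} \<subseteq> {c}" for c using p by (auto simp: leaves_def)
        then obtain a b where ab: "(p, a) \<in> parcs T" "(p, b) \<in> parcs T" "a \<noteq> b" by blast
        have "g a = (fst (g p), 0)" "g b = (fst (g p), 0)"
          using g(3)[OF ab(1)] g(3)[OF ab(2)] nz by (auto simp: EP_def prod_eq_iff)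
        then have "g a = g b" by simp
        then have "a = b" by (rule inj_onD[OF g(1)]) (use ab arcsT in auto)
        with ab(3) show False by simp
      qed
      have "inj_on (\<lambda>p. fst (g p)) ?VT'"
        using g(1) zero by (auto simp: inj_on_def prod_eq_iff)
      moreover have "fst (g p) \<in> ?VH" if "p \<in> ?VT'" for p
        using g(2) that by (auto simp: VP_def image_subset_iff mem_Times_iff)
      moreover have "(fst (g p), fst (g q)) \<in> ?EH" if "(p, q) \<in> Restr (parcs T) ?VT'" for p q
        using g(3)[of p q] zero[of p] zero[of q] that by (auto simp: EP_def)
      ultimately have "has_subgraph_iso H (prune T)"
        unfolding has_subgraph_iso_iff[OF wfT' wfH]
        by (intro exI[of _ "\<lambda>p. fst (g p)"]) (auto simp: prune_def)
      with H(2) show False by (simp add: free_of_def)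
    qed
    then have "has_subgraph_iso G P" by (rule weakly_universal_all_types[OF wu wfT cP])
    then obtain h where h: "inj_on h VP" "h ` VP \<subseteq> ?V" "\<And>x y. (x, y) \<in> EP \<Longrightarrow> (h x, h y) \<in> ?E"
      unfolding has_subgraph_iso_iff[OF wfP wfG] by (auto simp: P_def)
    have hV: "h (u, 0) \<in> V'" if u: "u \<in> ?VH" for u
    proof -
      have "inj_on (\<lambda>i. h (u, Suc i)) UNIV"
        using h(1) u by (auto simp: inj_on_def VP_def)
      then have "infinite (range (\<lambda>i. h (u, Suc i)))" by (rule range_inj_infinite)
      moreover have "range (\<lambda>i. h (u, Suc i)) \<subseteq> ?E `` {h (u, 0)}"
        using h(3) u by (auto simp: EP_def)
      ultimately have "infinite (?E `` {h (u, 0)})" using finite_subset by blast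
      moreover have "h (u, 0) \<in> ?V" using h(2) u by (auto simp: VP_def)
      ultimately show ?thesis by (simp add: V'_def)
    qed
    have "inj_on (\<lambda>u. h (u, 0)) ?VH" using h(1) by (auto simp: inj_on_def VP_def)
    moreover have "(h (u, 0), h (v, 0)) \<in> Restr ?E V'" if "(u, v) \<in> ?EH" for u v
      using that h(3)[of "(u, 0)" "(v, 0)"] hV H'(1) by (auto simp: EP_def)
    ultimately show ?thesis
      unfolding has_subgraph_iso_iff[OF wfH wfG'] using hV
      by (intro exI[of _ "\<lambda>u. h (u, 0)"]) (auto simp: G'_def)
  qed
  ultimately have "weakly_universal (prune T) G'" using cG' by (simp add: weakly_universal_def)
  then show ?thesis by blast
qed

section \<open>Trees with a unique vertex of maximal degree\<close>

text \<open>
  Pruning is repeated until a leaf appears next to the centre \<open>v0\<close>. Before that, no neighbour of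
  \<open>v0\<close> is removed, so its degree does not drop.
\<close>

lemma not_universal_of_unique_max_degree:
  fixes T :: "'a pair_pre_digraph" and G :: "'b pair_pre_digraph"
  assumes "tree_on (pverts T) (parcs T)" and "card (parcs T `` {v0}) = Suc r"
    and "\<And>p. p \<in> pverts T \<Longrightarrow> p \<noteq> v0 \<Longrightarrow> card (parcs T `` {p}) \<le> r" and "3 \<le> r"
  shows "\<not> weakly_universal T G"
  using assms
proof (induction "card (pverts T)" arbitrary: T G rule: less_induct)
  case less
  let ?V = "pverts T" and ?E = "parcs T"
  have fin: "finite ?V" and arcs: "?E \<subseteq> ?V \<times> ?V" and sym: "sym ?E" and conn: "connected_in ?E ?V"
    using less.prems(1) by (auto simp: tree_on_def)
  have finN: "finite (?E `` {q})" for q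
    using finite_subset[of "?E `` {q}" ?V] arcs fin by auto
  show ?case
  proof (cases "\<exists>l. (v0, l) \<in> ?E \<and> ?E `` {l} = {v0}")
    case True
    then show ?thesis using not_universal_of_leaf_at_centre[OF less.prems(1-3) _ _ less.prems(4)] by blast
  next
    case False
    have v0V: "v0 \<in> ?V"
    proof -
      have "?E `` {v0} \<noteq> {}" using less.prems(2) by auto
      then show ?thesis using arcs by blast
    qed
    have v0L: "v0 \<notin> leaves T"
    proof
      assume "v0 \<in> leaves T"
      then obtain p where "?E `` {v0} \<subseteq> {p}" by (auto simp: leaves_def)
      then have "card (?E `` {v0}) \<le> card {p}" by (intro card_mono) auto
      with less.prems(2,4) show False by simp
    qed
    \<comment> \<open>On the path from a leaf to the centre, the second vertex is the centre or has two neighbours.\<close>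
    have par: "\<exists>p\<in>?V - leaves T. (x, p) \<in> ?E" if x: "x \<in> leaves T" for x
    proof -
      have xV: "x \<in> ?V" using x by (simp add: leaves_def)
      obtain xs where xs: "xs \<noteq> []" "hd xs = x" "last xs = v0" "distinct xs" "set xs \<subseteq> ?V"
        "successively (\<lambda>x y. (x, y) \<in> ?E) xs"
        using connected_in_path[OF conn xV v0V] by blast
      have "x \<noteq> v0" using x v0L by blast
      then obtain p ys where xs_eq: "xs = x # p # ys"
        using xs(1-3) by (cases xs rule: remdups_adj.cases) auto
      have xp: "(x, p) \<in> ?E" "(p, x) \<in> ?E" using xs(6) symD[OF sym] by (auto simp: xs_eq)
      have "p \<notin> leaves T"
      proof (cases ys)
        case Nil
        then show ?thesis using xs(3) v0L by (simp add: xs_eq)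
      next
        case (Cons q zs)
        then have "(p, q) \<in> ?E" "q \<noteq> x" using xs(4,6) by (auto simp: xs_eq)
        with xp(2) show ?thesis by (auto simp: leaves_def)
      qed
      with xp(1) arcs show ?thesis by blast
    qed
    let ?T' = "prune T"
    have T'_eq: "pverts ?T' = ?V - leaves T" "parcs ?T' = Restr ?E (?V - leaves T)"
      by (simp_all add: prune_def)
    have "?E `` {v0} \<inter> leaves T = {}"
    proof (rule ccontr)
      assume "?E `` {v0} \<inter> leaves T \<noteq> {}"
      then obtain l p where l: "(v0, l) \<in> ?E" "?E `` {l} \<subseteq> {p}" by (auto simp: leaves_def)
      then have "?E `` {l} = {v0}" using symD[OF sym l(1)] by blast
      with l(1) False show False by blast
    qed
    then have "parcs ?T' `` {v0} = ?E `` {v0}" using arcs v0V v0L by (auto simp: T'_eq)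
    then have center: "card (parcs ?T' `` {v0}) = Suc r" using less.prems(2) by simp
    have others: "card (parcs ?T' `` {p}) \<le> r" if p: "p \<in> pverts ?T'" "p \<noteq> v0" for p
    proof -
      have "card (parcs ?T' `` {p}) \<le> card (?E `` {p})"
        using finN by (intro card_mono) (auto simp: T'_eq)
      also have "\<dots> \<le> r" using less.prems(3) p by (simp add: T'_eq)
      finally show ?thesis .
    qed
    have tree: "tree_on (pverts ?T') (parcs ?T')" unfolding T'_eq
      by (rule tree_on_remove_leaves[OF less.prems(1)]) (simp add: leaves_def)
    obtain x where "x \<in> leaves T"
      using tree_has_leaf[OF less.prems(1)] v0V by (auto simp: leaves_def)
    then have "pverts ?T' \<subset> ?V" by (auto simp: T'_eq leaves_def)
    then have "card (pverts ?T') < card ?V" using fin by (rule psubset_card_mono[rotated])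
    then have "\<not> weakly_universal ?T' G'" for G' :: "'b pair_pre_digraph"
      by (rule less.hyps[OF _ tree center others less.prems(4)])
    then show ?thesis using weakly_universal_prune[OF fin arcs sym par] by blast
  qed
qed

lemma out_degree_with_proj: "out_degree (with_proj T) v = card (parcs T `` {v})"
proof -
  have "out_arcs (with_proj T) v = Pair v ` (parcs T `` {v})" by (auto simp: out_arcs_def)
  then show ?thesis by (simp add: out_degree_def card_image inj_on_def)
qed

theorem proposition3p1:
  fixes T :: "'a pair_pre_digraph" and d :: nat
  assumes "finite_tree T"
    and "d = max_degree T"
    and "\<exists>!v. v \<in> pverts T \<and> out_degree (with_proj T) v = d"
    and "d \<ge> 4"
  shows "\<not> (\<exists>G :: 'b pair_pre_digraph. weakly_universal T G)"
proof -
  have tree: "tree_on (pverts T) (parcs T)" by (rule finite_tree_imp_tree_on[OF assms(1)])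
  then have fin: "finite (pverts T)" by (simp add: tree_on_def)
  obtain v0 where v0: "v0 \<in> pverts T" "out_degree (with_proj T) v0 = d"
    and uniq: "\<And>v. v \<in> pverts T \<Longrightarrow> out_degree (with_proj T) v = d \<Longrightarrow> v = v0"
    using assms(3) by blast
  have "card (parcs T `` {v0}) = Suc (d - 1)"
    using v0(2) assms(4) by (simp add: out_degree_with_proj)
  moreover have "card (parcs T `` {p}) \<le> d - 1" if p: "p \<in> pverts T" "p \<noteq> v0" for p
  proof -
    have "out_degree (with_proj T) p \<le> d"
      unfolding assms(2) max_degree_def using fin p(1) by (intro Max_ge) auto
    moreover have "out_degree (with_proj T) p \<noteq> d" using uniq p by blast
    ultimately show ?thesis by (simp add: out_degree_with_proj)
  qed
  moreover have "3 \<le> d - 1" using assms(4) by simp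
  ultimately have "\<not> weakly_universal T G" for G :: "'b pair_pre_digraph"
    by (rule not_universal_of_unique_max_degree[OF tree])
  then show ?thesis by blast
qed

end
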